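(* Let $G$ be a finite group of $F$-class $c \ge 1$ with covering group $G^*$ (with respect to some finite generating tuple of $G$). If $H$ is any descendant of $G$, then $H \cong G^*/U$ for some allowable subgroup $U$ of $G^*$.
   Context: For a finite group $X$, $F(X)$ is its Fitting subgroup; the $F$-central series is $\nu_0(X)=F(X)$ and $\nu_{i+1}(X)$ is the smallest normal subgroup $N'$ of $F(X)$ with $N'\le\nu_i(X)$ such that $\nu_i(X)/N'$ is centralized by $F(X)$ and is a direct product of elementary abelian groups; the $F$-class is the least $c$ with $\nu_c(X)=1$, and the $F$-rank is $|\nu_0(X)/\nu_1(X)|$. Covering group: with $g_1,\dots,g_n$ generating $G$, $F$ free on $f_1,\dots,f_n$, $\mu:F\to G$, $f_i\mapsto g_i$, $R=\ker\mu$, $L=\mu^{-1}(F(G))$, $k$ the product of the distinct primes dividing the $F$-rank of $G$: $G^*=F/[R,L]R^k$, $M=R/[R,L]R^k$. The nucleus is $N=\nu_c(G^* )$. A subgroup $U$ of $G^*$ is allowable if $U$ is a proper subgroup of $M$, normal in $G^*$, with $M=NU$. A group $H$ is a descendant of $G$ if $H$ has $F$-class $c+1$ and $H/\nu_c(H)\cong G$. *)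

theory Defs
  imports "HOL-Algebra.Algebra" "HOL-Computational_Algebra.Primes"
begin

definition comm_sub :: "('a, 'b) monoid_scheme \<Rightarrow> 'a set \<Rightarrow> 'a set \<Rightarrow> 'a set" where
  "comm_sub Gr A B = generate Gr
     {a \<otimes>\<^bsub>Gr\<^esub> b \<otimes>\<^bsub>Gr\<^esub> inv\<^bsub>Gr\<^esub> a \<otimes>\<^bsub>Gr\<^esub> inv\<^bsub>Gr\<^esub> b | a b. a \<in> A \<and> b \<in> B}"

definition pow_sub :: "('a, 'b) monoid_scheme \<Rightarrow> 'a set \<Rightarrow> nat \<Rightarrow> 'a set" where
  "pow_sub Gr A k = generate Gr {a [^]\<^bsub>Gr\<^esub> k | a. a \<in> A}"

fun lower_central :: "('a, 'b) monoid_scheme \<Rightarrow> nat \<Rightarrow> 'a set" where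
  "lower_central Gr 0 = carrier Gr"
| "lower_central Gr (Suc i) = comm_sub Gr (lower_central Gr i) (carrier Gr)"

definition nilpotent_grp :: "('a, 'b) monoid_scheme \<Rightarrow> bool" where
  "nilpotent_grp Gr \<longleftrightarrow> group Gr \<and> (\<exists>m. lower_central Gr m = {\<one>\<^bsub>Gr\<^esub>})"

definition Fitting :: "('a, 'b) monoid_scheme \<Rightarrow> 'a set" where
  "Fitting Gr = generate Gr (\<Union>{N. N \<lhd> Gr \<and> nilpotent_grp (subgroup_generated Gr N)})"

definition elementary_abelian :: "('a, 'b) monoid_scheme \<Rightarrow> bool" where
  "elementary_abelian E \<longleftrightarrow> comm_group E \<and>
     (\<exists>p. Factorial_Ring.prime (p::nat) \<and> (\<forall>x \<in> carrier E. x [^]\<^bsub>E\<^esub> p = \<one>\<^bsub>E\<^esub>))"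

text \<open>Q is (isomorphic to) a direct product of finitely many elementary abelian groups
  (component groups are taken on the countable carrier type nat, which loses nothing
  for finite groups).\<close>
definition dprod_elem_abelian :: "('a, 'b) monoid_scheme \<Rightarrow> bool" where
  "dprod_elem_abelian Q \<longleftrightarrow>
     (\<exists>(I::nat set) (E :: nat \<Rightarrow> nat monoid). finite I \<and>
        (\<forall>i \<in> I. elementary_abelian (E i)) \<and> Q \<cong> product_group I E)"

definition Fcs_admissible :: "('a, 'b) monoid_scheme \<Rightarrow> 'a set \<Rightarrow> 'a set \<Rightarrow> bool" where
  "Fcs_admissible Gr V N' \<longleftrightarrow>
     subgroup N' Gr \<and> N' \<subseteq> V \<and> N' \<lhd> subgroup_generated Gr (Fitting Gr) \<and>
     (\<forall>f \<in> Fitting Gr. \<forall>x \<in> V. f \<otimes>\<^bsub>Gr\<^esub> x \<otimes>\<^bsub>Gr\<^esub> inv\<^bsub>Gr\<^esub> f \<otimes>\<^bsub>Gr\<^esub> inv\<^bsub>Gr\<^esub> x \<in> N') \<and>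
     dprod_elem_abelian (subgroup_generated Gr V Mod N')"

fun Fcs :: "('a, 'b) monoid_scheme \<Rightarrow> nat \<Rightarrow> 'a set" where
  "Fcs Gr 0 = Fitting Gr"
| "Fcs Gr (Suc i) = \<Inter>{N'. Fcs_admissible Gr (Fcs Gr i) N'}"

definition has_F_class :: "('a, 'b) monoid_scheme \<Rightarrow> nat \<Rightarrow> bool" where
  "has_F_class Gr c \<longleftrightarrow> Fcs Gr c = {\<one>\<^bsub>Gr\<^esub>} \<and> (\<forall>j < c. Fcs Gr j \<noteq> {\<one>\<^bsub>Gr\<^esub>})"

definition F_rank :: "('a, 'b) monoid_scheme \<Rightarrow> nat" where
  "F_rank Gr = order (subgroup_generated Gr (Fcs Gr 0) Mod Fcs Gr 1)"

type_synonym word = "(nat \<times> bool) list"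

definition red_step :: "nat \<times> bool \<Rightarrow> word \<Rightarrow> word" where
  "red_step a acc = (case acc of [] \<Rightarrow> [a]
     | b # rest \<Rightarrow> (if fst a = fst b \<and> snd a \<noteq> snd b then rest else a # acc))"

definition free_reduce :: "word \<Rightarrow> word" where
  "free_reduce w = foldr red_step w []"

definition free_group :: "nat \<Rightarrow> word monoid" where
  "free_group n = \<lparr> carrier = {w. (\<forall>x \<in> set w. fst x < n) \<and> free_reduce w = w},
                   monoid.mult = (\<lambda>u v. free_reduce (u @ v)), monoid.one = [] \<rparr>"

definition word_eval :: "('a, 'b) monoid_scheme \<Rightarrow> (nat \<Rightarrow> 'a) \<Rightarrow> word \<Rightarrow> 'a" where
  "word_eval G g w = foldr (\<lambda>(i, b) acc. (if b then g i else inv\<^bsub>G\<^esub> (g i)) \<otimes>\<^bsub>G\<^esub> acc) w \<one>\<^bsub>G\<^esub>"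

definition cov_R :: "('a, 'b) monoid_scheme \<Rightarrow> (nat \<Rightarrow> 'a) \<Rightarrow> nat \<Rightarrow> word set" where
  "cov_R G g n = {w \<in> carrier (free_group n). word_eval G g w = \<one>\<^bsub>G\<^esub>}"

definition cov_L :: "('a, 'b) monoid_scheme \<Rightarrow> (nat \<Rightarrow> 'a) \<Rightarrow> nat \<Rightarrow> word set" where
  "cov_L G g n = {w \<in> carrier (free_group n). word_eval G g w \<in> Fitting G}"

definition cov_k :: "('a, 'b) monoid_scheme \<Rightarrow> nat" where
  "cov_k G = \<Prod>(prime_factors (F_rank G))"

definition cov_K :: "('a, 'b) monoid_scheme \<Rightarrow> (nat \<Rightarrow> 'a) \<Rightarrow> nat \<Rightarrow> word set" where
  "cov_K G g n = comm_sub (free_group n) (cov_R G g n) (cov_L G g n)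
                  <#>\<^bsub>free_group n\<^esub> pow_sub (free_group n) (cov_R G g n) (cov_k G)"

definition covering_group :: "('a, 'b) monoid_scheme \<Rightarrow> (nat \<Rightarrow> 'a) \<Rightarrow> nat \<Rightarrow> word set monoid" where
  "covering_group G g n = free_group n Mod cov_K G g n"

definition cov_M :: "('a, 'b) monoid_scheme \<Rightarrow> (nat \<Rightarrow> 'a) \<Rightarrow> nat \<Rightarrow> word set set" where
  "cov_M G g n = (\<lambda>r. cov_K G g n #>\<^bsub>free_group n\<^esub> r) ` cov_R G g n"

definition nucleus :: "('a, 'b) monoid_scheme \<Rightarrow> (nat \<Rightarrow> 'a) \<Rightarrow> nat \<Rightarrow> nat \<Rightarrow> word set set" where
  "nucleus G g n c = Fcs (covering_group G g n) c"

definition allowable :: "('a, 'b) monoid_scheme \<Rightarrow> (nat \<Rightarrow> 'a) \<Rightarrow> nat \<Rightarrow> nat \<Rightarrow> word set set \<Rightarrow> bool" where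
  "allowable G g n c U \<longleftrightarrow>
     subgroup U (covering_group G g n) \<and> U \<subseteq> cov_M G g n \<and> U \<noteq> cov_M G g n \<and>
     U \<lhd> covering_group G g n \<and>
     cov_M G g n = nucleus G g n c <#>\<^bsub>covering_group G g n\<^esub> U"

definition descendant :: "('c, 'd) monoid_scheme \<Rightarrow> ('a, 'b) monoid_scheme \<Rightarrow> bool" where
  "descendant H G \<longleftrightarrow> (\<exists>c. has_F_class G c \<and> has_F_class H (Suc c) \<and> (H Mod Fcs H c) \<cong> G)"

end

theory Submission
  imports Defs "HOL-Computational_Algebra.Squarefree" "HOL-Library.Countable_Set"
begin

text \<open>
  Let \<open>\<theta>\<close> be the projection of \<open>H\<close> onto \<open>G\<close>, with kernel \<open>Z = \<nu>\<^sub>c(H)\<close>. In a countable group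
  whose Fitting subgroup \<open>F\<close> has finite exponent, \<open>\<nu>\<^sub>i\<^sub>+\<^sub>1\<close> is generated by \<open>[F, \<nu>\<^sub>i]\<close> and the
  \<open>r\<close>-th powers of \<open>\<nu>\<^sub>i\<close>, where \<open>r\<close> is the radical of the exponent; so an epimorphism that maps
  the Fitting subgroup onto the Fitting subgroup maps the whole series onto the series.
  The same generators show three things about \<open>H\<close>. First, \<open>\<theta>\<^sup>-\<^sup>1(F(G))\<close> acts nilpotently on \<open>Z\<close>,
  because it does so on \<open>F(H)/Z\<close> and \<open>\<nu>\<^sub>c\<^sub>-\<^sub>1(H)/Z\<close>, whence \<open>F(H) = \<theta>\<^sup>-\<^sup>1(F(G))\<close>. Second, \<open>Z\<close> lies in
  every subgroup that covers \<open>G\<close>, so lifts of the generators of \<open>G\<close> generate \<open>H\<close>. Third, \<open>Z\<close> has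
  exponent dividing \<open>k\<close>. Therefore the epimorphism from the free group onto \<open>H\<close> given by the lifted
  generators kills \<open>[R, L]\<close> and \<open>R\<^sup>k\<close> and induces \<open>\<phi>\<close> from \<open>G\<^sup>*\<close> onto \<open>H\<close>. As \<open>F(G\<^sup>*)\<close> is the image
  of \<open>L\<close>, it is mapped onto \<open>F(H)\<close>, hence \<open>\<phi>\<close> maps the nucleus onto \<open>Z\<close>, which is also the image
  of \<open>M\<close>; so the kernel of \<open>\<phi>\<close> is allowable.
\<close>

section \<open>Commutator identities and the upper central series of a subgroup\<close>

section \<open>Commutators and nilpotency\<close>

text \<open>The factors stand in the order used by \<open>comm_sub\<close> and
  \<open>Fcs_admissible\<close>, so that both can be rewritten with it.\<close>

definition commutator :: "('a, 'b) monoid_scheme \<Rightarrow> 'a \<Rightarrow> 'a \<Rightarrow> 'a" where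
  "commutator G x y = x \<otimes>\<^bsub>G\<^esub> y \<otimes>\<^bsub>G\<^esub> inv\<^bsub>G\<^esub> x \<otimes>\<^bsub>G\<^esub> inv\<^bsub>G\<^esub> y"

context group
begin

lemma inv_mult_cancel:
  assumes "x \<in> carrier G" "y \<in> carrier G"
  shows "inv x \<otimes> (x \<otimes> y) = y" "x \<otimes> (inv x \<otimes> y) = y"
  using assms by (simp_all flip: m_assoc)

text \<open>Brackets to the right, inverses pushed to single letters, neighbouring inverse pairs
  cancelled: a normal form for words that proves the identities below by rewriting.\<close>

lemmas word_simps = m_assoc inv_mult_group inv_mult_cancel

lemma commutator_closed [simp, intro]:
  "x \<in> carrier G \<Longrightarrow> y \<in> carrier G \<Longrightarrow> commutator G x y \<in> carrier G"
  by (simp add: commutator_def)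

lemma commutator_one [simp]:
  "x \<in> carrier G \<Longrightarrow> commutator G \<one> x = \<one>" "x \<in> carrier G \<Longrightarrow> commutator G x \<one> = \<one>"
  by (simp_all add: commutator_def)

lemma commutator_eq_one_iff:
  assumes "x \<in> carrier G" "y \<in> carrier G"
  shows "commutator G x y = \<one> \<longleftrightarrow> x \<otimes> y = y \<otimes> x"
proof -
  have "commutator G x y = (x \<otimes> y) \<otimes> inv (y \<otimes> x)"
    using assms by (simp add: commutator_def word_simps)
  then show ?thesis
    using assms by (metis inv_closed inv_equality inv_inv m_closed r_inv)
qed

lemma inv_commutator:
  assumes "x \<in> carrier G" "y \<in> carrier G"
  shows "inv (commutator G x y) = commutator G y x"
  using assms by (simp add: commutator_def word_simps)

lemma mult_eq_commutator_mult:
  assumes "x \<in> carrier G" "y \<in> carrier G"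
  shows "x \<otimes> y = commutator G x y \<otimes> (y \<otimes> x)"
  using assms by (simp add: commutator_def word_simps)

lemma conj_eq_commutator_mult:
  assumes "a \<in> carrier G" "x \<in> carrier G"
  shows "a \<otimes> x \<otimes> inv a = commutator G a x \<otimes> x"
  using assms by (simp add: commutator_def word_simps)

lemma commutator_mult_left:
  assumes "x \<in> carrier G" "y \<in> carrier G" "z \<in> carrier G"
  shows "commutator G (x \<otimes> y) z = x \<otimes> commutator G y z \<otimes> inv x \<otimes> commutator G x z"
  using assms by (simp add: commutator_def word_simps)

lemma commutator_mult_right:
  assumes "x \<in> carrier G" "y \<in> carrier G" "z \<in> carrier G"
  shows "commutator G x (y \<otimes> z) = commutator G x y \<otimes> (y \<otimes> commutator G x z \<otimes> inv y)"
  using assms by (simp add: commutator_def word_simps)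

lemma commutator_inv_left:
  assumes "x \<in> carrier G" "z \<in> carrier G"
  shows "commutator G (inv x) z = inv x \<otimes> inv (commutator G x z) \<otimes> x"
  using assms by (simp add: commutator_def word_simps)

lemma conj_commutator:
  assumes "a \<in> carrier G" "x \<in> carrier G" "y \<in> carrier G"
  shows "a \<otimes> commutator G x y \<otimes> inv a = commutator G (a \<otimes> x \<otimes> inv a) (a \<otimes> y \<otimes> inv a)"
  using assms by (simp add: commutator_def word_simps)

lemma commutator_conj_left:
  assumes "a \<in> carrier G" "b \<in> carrier G" "x \<in> carrier G"
  shows "commutator G (b \<otimes> x \<otimes> inv b) a = b \<otimes> commutator G x (inv b \<otimes> a \<otimes> b) \<otimes> inv b"
  using assms by (simp add: commutator_def word_simps)

lemma conj_nat_pow: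
  assumes "a \<in> carrier G" "x \<in> carrier G"
  shows "a \<otimes> x [^] (k::nat) \<otimes> inv a = (a \<otimes> x \<otimes> inv a) [^] k"
proof (induction k)
  case (Suc k)
  have "a \<otimes> x [^] Suc k \<otimes> inv a = (a \<otimes> x [^] k \<otimes> inv a) \<otimes> (a \<otimes> x \<otimes> inv a)"
    using assms by (simp add: word_simps)
  then show ?case by (simp add: Suc)
qed (use assms in simp)

end

lemma (in group_hom) hom_commutator:
  "x \<in> carrier G \<Longrightarrow> y \<in> carrier G \<Longrightarrow> h (commutator G x y) = commutator H (h x) (h y)"
  by (simp add: commutator_def)

text \<open>The upper central series of the subgroup \<open>A\<close>, taken with the operations of
  the ambient group, so that homomorphic images can be compared without changing the group
  structure.\<close>

fun upper_central :: "('a, 'b) monoid_scheme \<Rightarrow> 'a set \<Rightarrow> nat \<Rightarrow> 'a set" where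
  "upper_central G A 0 = {\<one>\<^bsub>G\<^esub>}"
| "upper_central G A (Suc j) = {x \<in> A. \<forall>a \<in> A. commutator G x a \<in> upper_central G A j}"

context group
begin

text \<open>One joint induction is needed: products and inverses in the next term are treated by
  \<open>commutator_mult_left\<close> and \<open>commutator_inv_left\<close>, which conjugate
  elements of the current term.\<close>

lemma upper_central_normal_subgroup:
  assumes A: "subgroup A G"
  shows "subgroup (upper_central G A j) G \<and> upper_central G A j \<subseteq> A \<and>
    (\<forall>b \<in> A. \<forall>x \<in> upper_central G A j. b \<otimes> x \<otimes> inv b \<in> upper_central G A j)"
proof (induction j)
  case 0
  interpret A: subgroup A G by fact
  show ?case by (auto simp: triv_subgroup)
next
  case (Suc j)
  interpret A: subgroup A G by fact
  interpret U: subgroup "upper_central G A j" G using Suc by blast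
  have nrm: "b \<otimes> x \<otimes> inv b \<in> upper_central G A j"
    if "b \<in> A" "x \<in> upper_central G A j" for b x using Suc that by blast
  have "subgroup (upper_central G A (Suc j)) G"
  proof (rule subgroupI)
    show "upper_central G A (Suc j) \<subseteq> carrier G" using A.subset by auto
    have "\<one> \<in> upper_central G A (Suc j)" by auto
    then show "upper_central G A (Suc j) \<noteq> {}" by blast
  next
    fix x assume x: "x \<in> upper_central G A (Suc j)"
    then have xc: "x \<in> A" by simp
    have "commutator G (inv x) a \<in> upper_central G A j" if "a \<in> A" for a
      using x xc that nrm[of "inv x" "inv (commutator G x a)"]
      by (simp add: commutator_inv_left)
    then show "inv x \<in> upper_central G A (Suc j)" using xc by simp
  next
    fix x y assume "x \<in> upper_central G A (Suc j)" "y \<in> upper_central G A (Suc j)"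
    then show "x \<otimes> y \<in> upper_central G A (Suc j)"
      by (simp add: commutator_mult_left nrm)
  qed
  moreover have "b \<otimes> x \<otimes> inv b \<in> upper_central G A (Suc j)"
    if "b \<in> A" "x \<in> upper_central G A (Suc j)" for b x
    using that by (auto simp: commutator_conj_left intro!: nrm)
  ultimately show ?case by auto
qed

lemma upper_central_subgroup: "subgroup A G \<Longrightarrow> subgroup (upper_central G A j) G"
  and upper_central_subset: "subgroup A G \<Longrightarrow> upper_central G A j \<subseteq> A"
  and upper_central_conj: "subgroup A G \<Longrightarrow> b \<in> A \<Longrightarrow> x \<in> upper_central G A j \<Longrightarrow>
    b \<otimes> x \<otimes> inv b \<in> upper_central G A j"
  using upper_central_normal_subgroup by blast+

lemma upper_central_Suc_mono:
  assumes "subgroup A G"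
  shows "upper_central G A j \<subseteq> upper_central G A (Suc j)"
proof
  fix x assume x: "x \<in> upper_central G A j"
  interpret A: subgroup A G by fact
  interpret U: subgroup "upper_central G A j" G by (rule upper_central_subgroup[OF assms])
  have xA: "x \<in> A" using x upper_central_subset[OF assms] by blast
  have "commutator G x a \<in> upper_central G A j" if a: "a \<in> A" for a
  proof -
    have "commutator G x a = x \<otimes> (a \<otimes> inv x \<otimes> inv a)"
      using xA a by (simp add: commutator_def word_simps)
    then show ?thesis
      using upper_central_conj[OF assms a U.m_inv_closed[OF x]] x by simp
  qed
  then show "x \<in> upper_central G A (Suc j)" using xA by simp
qed

lemma upper_central_mono:
  "subgroup A G \<Longrightarrow> i \<le> j \<Longrightarrow> upper_central G A i \<subseteq> upper_central G A j"
  by (rule lift_Suc_mono_le[of "upper_central G A"]) (simp_all only: upper_central_Suc_mono)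

lemma commutator_subgroup_generated:
  assumes "subgroup A G" "x \<in> A" "y \<in> A"
  shows "commutator (subgroup_generated G A) x y = commutator G x y"
  using assms by (simp add: commutator_def subgroup.carrier_subgroup_generated_subgroup)

text \<open>The lower series read upward from a trivial term stays inside the upper series;
  conversely, an upper series that reaches \<open>A\<close>, read downward, bounds the lower one.
  Commutators with \<open>A\<close> move one step down in both.\<close>

lemma nilpotent_iff_upper_central:
  assumes A: "subgroup A G"
  shows "nilpotent_grp (subgroup_generated G A) \<longleftrightarrow> (\<exists>j. A \<subseteq> upper_central G A j)"
proof -
  interpret A: subgroup A G by fact
  let ?S = "subgroup_generated G A"
  interpret S: group ?S by simp
  have car: "carrier ?S = A" by simp
  have sub: "lower_central ?S i \<subseteq> A" for i
  proof (induction i)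
    case (Suc i)
    then show ?case
      unfolding lower_central.simps comm_sub_def
      using car by (intro S.generate_incl[unfolded car]) (auto)
  qed simp
  have gens: "lower_central ?S (Suc i) = generate ?S {commutator G x a | x a. x \<in> lower_central ?S i \<and> a \<in> A}" for i
  proof -
    have "{a \<otimes>\<^bsub>?S\<^esub> b \<otimes>\<^bsub>?S\<^esub> inv\<^bsub>?S\<^esub> a \<otimes>\<^bsub>?S\<^esub> inv\<^bsub>?S\<^esub> b |a b. a \<in> lower_central ?S i \<and> b \<in> carrier ?S}
      = {commutator G x a | x a. x \<in> lower_central ?S i \<and> a \<in> A}"
      unfolding commutator_def[of ?S, symmetric] car
      using sub[of i] commutator_subgroup_generated[OF A] by (metis (no_types, opaque_lifting) subsetD)
    then show ?thesis by (simp only: lower_central.simps comm_sub_def)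
  qed
  show ?thesis
  proof
    assume "nilpotent_grp ?S"
    then obtain m where m: "lower_central ?S m = {\<one>}" by (auto simp: nilpotent_grp_def)
    have "lower_central ?S (m - j) \<subseteq> upper_central G A j" if "j \<le> m" for j
      using that
    proof (induction j)
      case (Suc j)
      then have e: "m - j = Suc (m - Suc j)" by simp
      show ?case
      proof
        fix x assume x: "x \<in> lower_central ?S (m - Suc j)"
        have "commutator G x a \<in> lower_central ?S (m - j)" if "a \<in> A" for a
          unfolding e gens using x that by (intro generate.incl) auto
        then show "x \<in> upper_central G A (Suc j)"
          using Suc x sub by auto
      qed
    qed (simp add: m)
    from this[of m] show "\<exists>j. A \<subseteq> upper_central G A j" by auto
  next
    assume "\<exists>j. A \<subseteq> upper_central G A j"
    then obtain j where j: "A \<subseteq> upper_central G A j" by blast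
    have "lower_central ?S i \<subseteq> upper_central G A (j - i)" if "i \<le> j" for i
      using that
    proof (induction i)
      case (Suc i)
      then have e: "j - i = Suc (j - Suc i)" by simp
      have "subgroup (upper_central G A (j - Suc i)) ?S"
        using upper_central_subgroup[OF A] upper_central_subset[OF A]
        by (metis A subgroup_of_subgroup_generated)
      moreover have "{commutator G x a | x a. x \<in> lower_central ?S i \<and> a \<in> A}
         \<subseteq> upper_central G A (j - Suc i)" using Suc e by auto
      ultimately show ?case unfolding gens by (rule S.generate_subgroup_incl[rotated])
    qed (use j in simp)
    from this[of j] have "lower_central ?S j \<subseteq> {\<one>}" by simp
    moreover have "\<one> \<in> lower_central ?S j"
      by (cases j) (use generate.one[of ?S] in \<open>auto simp: comm_sub_def\<close>)
    ultimately show "nilpotent_grp ?S" unfolding nilpotent_grp_def by auto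
  qed
qed

section \<open>The Fitting subgroup and its behaviour under epimorphisms\<close>

lemma Fitting_normal: "Fitting G \<lhd> G"
  unfolding Fitting_def
proof (rule normal_generateI)
  show "\<Union> {N. N \<lhd> G \<and> nilpotent_grp (subgroup_generated G N)} \<subseteq> carrier G"
    using normal_imp_subgroup subgroup.subset by blast
qed (auto dest: normal.inv_op_closed2)

lemma Fitting_subgroup: "subgroup (Fitting G) G"
  using Fitting_normal by (rule normal_imp_subgroup)

lemma normal_subset_Fitting:
  assumes "A \<lhd> G" "A \<subseteq> upper_central G A j"
  shows "A \<subseteq> Fitting G"
proof -
  have "nilpotent_grp (subgroup_generated G A)"
    using assms normal_imp_subgroup nilpotent_iff_upper_central by blast
  then show ?thesis unfolding Fitting_def using assms(1) by (auto intro: generate.incl)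
qed

end

context group_hom
begin

lemma image_upper_central:
  assumes "A \<subseteq> carrier G"
  shows "h ` upper_central G A j \<subseteq> upper_central H (h ` A) j"
proof (induction j)
  case (Suc j)
  show ?case
  proof clarify
    fix x assume x: "x \<in> upper_central G A (Suc j)"
    have "commutator H (h x) (h a) \<in> upper_central H (h ` A) j" if "a \<in> A" for a
    proof -
      have "h (commutator G x a) \<in> upper_central H (h ` A) j"
        using Suc x that by auto
      then show ?thesis using x that assms by (subst (asm) hom_commutator) auto
    qed
    then show "h x \<in> upper_central H (h ` A) (Suc j)" using x by auto
  qed
qed simp

text \<open>Surjectivity makes images of normal subgroups normal, and
  \<open>image_upper_central\<close> keeps them nilpotent.\<close>

lemma image_Fitting_subset:
  assumes surj: "h ` carrier G = carrier H"
  shows "h ` Fitting G \<subseteq> Fitting H"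
proof -
  let ?U = "\<Union> {N. N \<lhd> G \<and> nilpotent_grp (subgroup_generated G N)}"
  have U: "?U \<subseteq> carrier G"
    using normal_imp_subgroup subgroup.subset by blast
  have "h ` N \<subseteq> Fitting H" if N: "N \<lhd> G" "nilpotent_grp (subgroup_generated G N)" for N
  proof -
    have s: "subgroup N G" using N normal_imp_subgroup by blast
    then obtain j where "N \<subseteq> upper_central G N j"
      using N G.nilpotent_iff_upper_central by blast
    then have "h ` N \<subseteq> upper_central H (h ` N) j"
      using image_upper_central[of N j] s subgroup.subset by blast
    moreover have "h ` N \<lhd> H"
      using normal.surj_hom_normal_subgroup[OF N(1)] group_hom_axioms surj by blast
    ultimately show ?thesis using H.normal_subset_Fitting by blast
  qed
  then have "h ` ?U \<subseteq> Fitting H" by blast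
  then show ?thesis
    unfolding Fitting_def[of G] generate_img[OF U, symmetric]
    by (rule H.generate_subgroup_incl[OF _ H.Fitting_subgroup])
qed

text \<open>The preimage \<open>?A\<close> is nilpotent because the pulled-back upper central series
  of \<open>Fitting H\<close> stacks on top of the \<open>j\<close> steps that absorb the kernel.
  This serves both the covering group over \<open>G\<close>, with \<open>j = 1\<close>, and a
  descendant over \<open>G\<close>.\<close>

lemma Fitting_eq_vimage:
  assumes surj: "h ` carrier G = carrier H"
    and nilp: "Fitting H \<subseteq> upper_central H (Fitting H) m"
    and ker: "kernel G H h \<subseteq> upper_central G {x \<in> carrier G. h x \<in> Fitting H} j"
  shows "Fitting G = {x \<in> carrier G. h x \<in> Fitting H}" (is "_ = ?A")
proof
  show "Fitting G \<subseteq> ?A"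
    using image_Fitting_subset[OF surj] G.Fitting_subgroup subgroup.subset by blast
  interpret N: normal "Fitting H" H by (rule H.Fitting_normal)
  have nA: "?A \<lhd> G"
    unfolding G.normal_inv_iff
    by (auto intro!: G.subgroupI N.inv_op_closed2)
  have "{x \<in> ?A. h x \<in> upper_central H (Fitting H) i} \<subseteq> upper_central G ?A (i + j)" for i
  proof (induction i)
    case 0
    then show ?case using ker by (auto simp: kernel_def)
  next
    case (Suc i)
    show ?case
    proof
      fix x assume x: "x \<in> {x \<in> ?A. h x \<in> upper_central H (Fitting H) (Suc i)}"
      have "commutator G x a \<in> {x \<in> ?A. h x \<in> upper_central H (Fitting H) i}" if "a \<in> ?A" for a
        using x that H.upper_central_subset[OF H.Fitting_subgroup, of i]
        by (auto simp: hom_commutator)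
      then show "x \<in> upper_central G ?A (Suc i + j)"
        using x Suc by auto
    qed
  qed
  from this[of m] have "?A \<subseteq> upper_central G ?A (m + j)" using nilp by blast
  then show "?A \<subseteq> Fitting G" using nA G.normal_subset_Fitting by blast
qed

end

section \<open>Squarefree exponents and products of elementary abelian groups\<close>

section \<open>Direct products of elementary abelian groups\<close>

text \<open>A squarefree number is the product of its prime divisors. This is what replaces an
  exponent by its radical.\<close>

lemma squarefree_dvd_prod_prime_factors:
  assumes "squarefree (d::nat)" "d dvd e" "e \<noteq> 0"
  shows "d dvd \<Prod>(prime_factors e)"
proof -
  have "d \<noteq> 0" using assms by auto
  then have "d = (\<Prod>p\<in>prime_factors d. p ^ multiplicity p d)"
    by (simp add: prime_factorization_nat)
  also have "\<dots> = \<Prod>(prime_factors d)"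
    using assms(1) \<open>d \<noteq> 0\<close>
    by (intro prod.cong) (auto simp: squarefree_factorial_semiring')
  also have "\<dots> dvd \<Prod>(prime_factors e)"
    using assms by (intro prod_dvd_prod_subset dvd_prime_factors) auto
  finally show ?thesis .
qed

lemma squarefree_prod_primes:
  assumes "\<And>p. p \<in> P \<Longrightarrow> Factorial_Ring.prime (p::nat)"
  shows "squarefree (\<Prod>P)"
  using assms by (intro squarefree_prod_coprime) (auto simp: primes_coprime squarefree_prime)

lemma pow_product_group:
  assumes "\<And>i. i \<in> I \<Longrightarrow> group (E i)" "x \<in> carrier (product_group I E)"
  shows "x [^]\<^bsub>product_group I E\<^esub> (k::nat) = (\<lambda>i\<in>I. x i [^]\<^bsub>E i\<^esub> k)"
  using assms by (induction k) (auto simp: restrict_def)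

lemma dprod_elem_abelian_exponent:
  assumes Q: "group Q" and dp: "dprod_elem_abelian Q"
  obtains s :: nat where "squarefree s" "\<And>x. x \<in> carrier Q \<Longrightarrow> x [^]\<^bsub>Q\<^esub> s = \<one>\<^bsub>Q\<^esub>"
proof -
  obtain I :: "nat set" and E :: "nat \<Rightarrow> nat monoid" where I: "finite I"
    and E: "\<And>i. i \<in> I \<Longrightarrow> elementary_abelian (E i)" and iso: "Q \<cong> product_group I E"
    using dp unfolding dprod_elem_abelian_def by blast
  obtain f where f: "f \<in> iso Q (product_group I E)" using iso by (auto simp: is_iso_def)
  have gE: "group (E i)" if "i \<in> I" for i
    using E[OF that] by (simp add: elementary_abelian_def comm_group_def)
  have "\<exists>p. \<forall>i\<in>I. Factorial_Ring.prime (p i :: nat) \<and> (\<forall>x \<in> carrier (E i). x [^]\<^bsub>E i\<^esub> p i = \<one>\<^bsub>E i\<^esub>)"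
    using E unfolding elementary_abelian_def by (intro bchoice) blast
  then obtain p where p: "\<And>i. i \<in> I \<Longrightarrow> Factorial_Ring.prime (p i :: nat)"
    "\<And>i x. i \<in> I \<Longrightarrow> x \<in> carrier (E i) \<Longrightarrow> x [^]\<^bsub>E i\<^esub> p i = \<one>\<^bsub>E i\<^esub>" by blast
  interpret f: group_hom Q "product_group I E" f
    using Q gE f by (intro group_hom.intro group_hom_axioms.intro) (auto simp: iso_def)
  have inj: "inj_on f (carrier Q)" using f by (auto simp: iso_def bij_betw_def)
  \<comment> \<open>The product runs over the set of primes, not over the indices: a prime shared by
    several factors counts once, so the exponent is squarefree.\<close>
  let ?s = "\<Prod>(p ` I)"
  have "x [^]\<^bsub>Q\<^esub> ?s = \<one>\<^bsub>Q\<^esub>" if x: "x \<in> carrier Q" for x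
  proof -
    have fx: "f x \<in> carrier (product_group I E)" using x by (rule f.hom_closed)
    have "f x i [^]\<^bsub>E i\<^esub> ?s = \<one>\<^bsub>E i\<^esub>" if i: "i \<in> I" for i
    proof -
      have "p i dvd ?s" using I i by auto
      moreover have "f x i \<in> carrier (E i)" using fx i by auto
      ultimately show ?thesis using p(2)[OF i, of "f x i"] group.pow_eq_id[OF gE[OF i]]
        by (meson dvd_trans)
    qed
    then have "f (x [^]\<^bsub>Q\<^esub> ?s) = \<one>\<^bsub>product_group I E\<^esub>"
      using x by (subst f.hom_nat_pow) (auto simp: pow_product_group[OF gE fx] restrict_def)
    then show ?thesis
      by (intro inj_onD[OF inj]) (use x in auto)
  qed
  moreover have "squarefree ?s" by (rule squarefree_prod_primes) (use p in auto)
  ultimately show thesis using that by blast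
qed

lemma (in comm_group) finprod_nat_pow:
  assumes "f \<in> A \<rightarrow> carrier G"
  shows "finprod G f A [^] (k::nat) = (\<Otimes>i\<in>A. f i [^] k)"
proof (cases "finite A")
  case True
  then show ?thesis using assms
    by (induction A) (auto simp: Pi_iff nat_pow_distrib)
qed simp

text \<open>Countability is needed because the factors in the definition live on type \<^typ>\<open>nat\<close>.\<close>

lemma (in comm_group) dprod_elem_abelianI:
  assumes cnt: "countable (carrier G)" and P: "finite P" "\<And>p. p \<in> P \<Longrightarrow> Factorial_Ring.prime (p::nat)"
    and ex: "\<And>x. x \<in> carrier G \<Longrightarrow> x [^] (\<Prod>P) = \<one>"
  shows "dprod_elem_abelian G"
proof -
  obtain c :: "'a \<Rightarrow> nat" where c: "inj_on c (carrier G)" using cnt by (auto simp: countable_def)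
  define d where "d = inv_into (carrier G) c"
  have d [simp]: "d (c x) = x" if "x \<in> carrier G" for x using c that by (simp add: d_def)
  define S where "S = (\<lambda>p::nat. {x \<in> carrier G. x [^] p = \<one>})"
  \<comment> \<open>The \<open>p\<close>-torsion subgroup \<open>S p\<close>, transported to
    \<open>nat\<close> along \<open>c\<close>.\<close>
  define E where "E = (\<lambda>p. \<lparr>carrier = c ` S p, monoid.mult = (\<lambda>a b. c (d a \<otimes> d b)), monoid.one = c \<one>\<rparr>)"
  have S: "S p \<subseteq> carrier G" "\<one> \<in> S p" "x \<in> S p \<Longrightarrow> y \<in> S p \<Longrightarrow> x \<otimes> y \<in> S p"
    "x \<in> S p \<Longrightarrow> inv x \<in> S p" for p x y
    by (auto simp: S_def nat_pow_distrib nat_pow_inv)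
  have cgE: "comm_group (E p)" for p
  proof (rule comm_groupI)
    fix x assume "x \<in> carrier (E p)"
    then obtain y where y: "y \<in> S p" "x = c y" by (auto simp: E_def)
    then show "\<exists>y\<in>carrier (E p). y \<otimes>\<^bsub>E p\<^esub> x = \<one>\<^bsub>E p\<^esub>"
      using S by (intro bexI[of _ "c (inv y)"]) (auto simp: E_def subset_iff)
  qed (use S in \<open>auto simp: E_def subset_iff m_ac\<close>)
  have powE: "c x [^]\<^bsub>E p\<^esub> (k::nat) = c (x [^] k)" if "x \<in> S p" for x p k
  proof (induction k)
    case (Suc k)
    then show ?case using that S(1)[of p] by (auto simp: E_def)
  qed (simp add: E_def)
  have elE: "elementary_abelian (E p)" if "p \<in> P" for p
    unfolding elementary_abelian_def using cgE P(2)[OF that] powE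
    by (auto simp: E_def S_def intro!: exI[of _ p])
  \<comment> \<open>\<open>q p\<close> is the cofactor of \<open>p\<close> in the exponent; raising
    to this power lands in the \<open>p\<close>-torsion, and \<open>\<Phi>\<close> collects these
    maps.\<close>
  define q where "q = (\<lambda>p. \<Prod>(P - {p}))"
  have pq: "\<Prod>P = p * q p" if "p \<in> P" for p
    using P(1) that by (simp add: q_def prod.remove)
  have dvdq: "p dvd q t" if "p \<in> P" "t \<noteq> p" for p t
    using P(1) that by (auto simp: q_def)
  have copq: "coprime (q p) p" if "p \<in> P" for p
    using P that unfolding q_def by (intro prod_coprime_left) (auto intro: primes_coprime)
  define \<Phi> where "\<Phi> = (\<lambda>x. \<lambda>p\<in>P. c (x [^] q p))"
  have Sq: "x [^] q p \<in> S p" if "x \<in> carrier G" "p \<in> P" for x p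
    using ex[OF that(1)] that pq[OF that(2)] by (simp add: S_def nat_pow_pow mult.commute)
  have hom: "\<Phi> \<in> hom G (product_group P E)"
    by (rule homI) (auto simp: \<Phi>_def E_def Sq nat_pow_distrib)
  interpret \<Phi>: group_hom G "product_group P E" \<Phi>
    using hom cgE by (intro group_hom.intro group_hom_axioms.intro) (auto simp: comm_group_def)
  \<comment> \<open>A prime dividing the order of a nontrivial kernel element belongs to
    \<open>P\<close> and would then divide its own cofactor.\<close>
  have inj: "x = \<one>" if x: "x \<in> carrier G" "\<Phi> x = \<one>\<^bsub>product_group P E\<^esub>" for x
  proof (rule ccontr)
    assume "x \<noteq> \<one>"
    then have "ord x \<noteq> 1" using x ord_eq_1 by blast
    then obtain p where p: "Factorial_Ring.prime p" "p dvd ord x" using prime_factor_nat by blast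
    have "ord x dvd \<Prod>P" using ex x by (simp add: pow_eq_id)
    then have "p dvd \<Prod>P" using p by (meson dvd_trans)
    then obtain t where "t \<in> P" "p dvd t" using P(1) p(1) by (auto simp: prime_dvd_prod_iff)
    then have pP: "p \<in> P" using P(2) p(1) primes_dvd_imp_eq by blast
    have "\<Phi> x p = \<one>\<^bsub>product_group P E\<^esub> p" using x by simp
    then have "c (x [^] q p) = c \<one>" using pP by (simp add: \<Phi>_def E_def)
    then have "x [^] q p = \<one>" using c x by (simp add: inj_on_eq_iff)
    then have "ord x dvd q p" using x by (simp add: pow_eq_id)
    then have "p dvd q p" using p by (meson dvd_trans)
    then show False using copq[OF pP] p(1) by (metis coprime_common_divisor dvd_refl not_prime_unit)
  qed
  have surj: "y \<in> \<Phi> ` carrier G" if y: "y \<in> carrier (product_group P E)" for y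
  proof -
    define z where "z = (\<lambda>p. d (y p))"
    have z: "z p \<in> S p" "y p = c (z p)" if "p \<in> P" for p
    proof -
      have "y p \<in> c ` S p" using y that by (auto simp: E_def)
      then show "z p \<in> S p" "y p = c (z p)" using S(1)[of p] by (auto simp: z_def)
    qed
    \<comment> \<open>By Bezout \<open>q p\<close> is invertible modulo \<open>p\<close>, so its
      power map can be undone on the \<open>p\<close>-torsion.\<close>
    have "\<exists>a. \<forall>p\<in>P. z p [^] (a p * q p :: nat) = z p"
    proof (intro bchoice ballI)
      fix p assume p: "p \<in> P"
      have "0 \<notin> P" using P(2) by fastforce
      then have "q p \<noteq> 0" using P(1) by (simp add: q_def)
      then obtain a b where "q p * a = p * b + gcd (q p) p" using bezout_nat by blast
      then have e: "a * q p = p * b + 1" using copq[OF p] by (simp add: mult.commute coprime_iff_gcd_eq_1)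
      have zp: "z p \<in> carrier G" "z p [^] p = \<one>" using z[OF p] by (auto simp: S_def)
      have "z p [^] (a * q p) = (z p [^] p) [^] b \<otimes> z p"
        unfolding e nat_pow_pow[OF zp(1)] using zp(1) by (simp flip: nat_pow_mult)
      then show "\<exists>a. z p [^] (a * q p) = z p" using zp by auto
    qed
    then obtain a :: "nat \<Rightarrow> nat" where a: "\<And>p. p \<in> P \<Longrightarrow> z p [^] (a p * q p) = z p" by blast
    define x where "x = (\<Otimes>p\<in>P. z p [^] a p)"
    have zc: "z p \<in> carrier G" if "p \<in> P" for p using z[OF that] S(1) by blast
    have xc: "x \<in> carrier G" unfolding x_def using zc by (intro finprod_closed) auto
    have "x [^] q t = z t" if t: "t \<in> P" for t
    proof -
      have "x [^] q t = (\<Otimes>p\<in>P. (z p [^] a p) [^] q t)"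
        unfolding x_def using zc by (intro finprod_nat_pow) auto
      \<comment> \<open>A factor at \<open>p \<noteq> t\<close> vanishes because \<open>p\<close>
        divides \<open>q t\<close>; the factor at \<open>t\<close> is restored by the choice of
        \<open>a\<close>.\<close>
      also have "\<dots> = (\<Otimes>p\<in>P. if t = p then z p else \<one>)"
      proof (rule finprod_cong')
        fix p assume p: "p \<in> P"
        show "(z p [^] a p) [^] q t = (if t = p then z p else \<one>)"
        proof (cases "t = p")
          case False
          then have "p dvd a p * q t" using dvdq[OF p] by simp
          moreover have "ord (z p) dvd p" using z[OF p] pow_eq_id[of "z p" p] by (auto simp: S_def)
          ultimately have "z p [^] (a p * q t) = \<one>" using zc[OF p] by (meson dvd_trans pow_eq_id)
          then show ?thesis using False zc[OF p] by (simp add: nat_pow_pow)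
        qed (use a[OF p] zc[OF p] in \<open>simp add: nat_pow_pow\<close>)
      qed (use zc in auto)
      also have "\<dots> = z t" using P(1) t zc by (intro finprod_singleton) auto
      finally show ?thesis .
    qed
    then have "\<Phi> x = y" using z y by (auto simp: \<Phi>_def fun_eq_iff PiE_iff extensional_def)
    then show ?thesis using xc by blast
  qed
  have "\<Phi> \<in> iso G (product_group P E)"
    unfolding \<Phi>.iso_iff using inj surj by blast
  then show ?thesis
    unfolding dprod_elem_abelian_def is_iso_def using P(1) elE by blast
qed

section \<open>Admissible subgroups and the terms of the F-central series\<close>

section \<open>The F-central series\<close>

context group
begin

text \<open>A conjugate \<open>f x f^-1\<close> is \<open>[f, x] x\<close>. The lemma supplies
  normality both in a term of the series and in the whole Fitting subgroup.\<close>

lemma commutator_closed_imp_normal: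
  assumes V: "subgroup V G" and N: "subgroup N G" "N \<subseteq> V"
    and comm: "\<And>f x. f \<in> V \<Longrightarrow> x \<in> N \<Longrightarrow> commutator G f x \<in> N"
  shows "N \<lhd> subgroup_generated G V"
proof -
  interpret S: group "subgroup_generated G V" by simp
  interpret V: subgroup V G by fact
  interpret N: subgroup N G by fact
  have "f \<otimes> x \<otimes> inv f \<in> N" if "f \<in> V" "x \<in> N" for f x
    using comm[OF that] that by (simp add: conj_eq_commutator_mult)
  moreover have "subgroup N (subgroup_generated G V)"
    using N V subgroup_of_subgroup_generated by blast
  ultimately show ?thesis
    using V by (simp add: S.normal_inv_iff)
qed

lemma rcoset_pow_eq_one_iff:
  assumes V: "subgroup V G" and N: "N \<lhd> subgroup_generated G V" and x: "x \<in> V"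
  defines "Q \<equiv> subgroup_generated G V Mod N"
  shows "(N #>\<^bsub>subgroup_generated G V\<^esub> x) [^]\<^bsub>Q\<^esub> (k::nat) = \<one>\<^bsub>Q\<^esub> \<longleftrightarrow> x [^] k \<in> N"
proof -
  interpret S: group "subgroup_generated G V" by simp
  interpret N: normal N "subgroup_generated G V" by fact
  interpret V: subgroup V G by fact
  have *: "(N #>\<^bsub>subgroup_generated G V\<^esub> x) [^]\<^bsub>Q\<^esub> k = N #>\<^bsub>subgroup_generated G V\<^esub> (x [^] k)"
    using N.FactGroup_pow[of x k] x by (simp add: Q_def pow_subgroup_generated)
  have "x [^] k \<in> V" using x by (induction k) auto
  then show ?thesis
    unfolding * using S.coset_join1[OF _ _ N.subgroup_axioms] S.coset_join2[OF _ N.subgroup_axioms]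
      N.subset by (auto simp: Q_def)
qed

text \<open>Reduces admissibility to commutators and powers: the quotient is abelian because
  \<open>V\<close> lies in the Fitting subgroup, and a product of distinct primes as exponent splits
  it into elementary abelian factors.\<close>

lemma Fcs_admissibleI:
  assumes cnt: "countable (carrier G)"
    and V: "subgroup V G" "V \<subseteq> Fitting G" and N: "subgroup N G" "N \<subseteq> V"
    and comm: "\<And>f x. f \<in> Fitting G \<Longrightarrow> x \<in> V \<Longrightarrow> commutator G f x \<in> N"
    and P: "finite P" "\<And>p. p \<in> P \<Longrightarrow> Factorial_Ring.prime (p::nat)"
    and pow: "\<And>x. x \<in> V \<Longrightarrow> x [^] (\<Prod>P) \<in> N"
  shows "Fcs_admissible G V N"
proof -
  let ?S = "subgroup_generated G V"
  interpret S: group ?S by simp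
  interpret V: subgroup V G by fact
  have nV: "N \<lhd> ?S"
    using V N comm by (intro commutator_closed_imp_normal) auto
  interpret N: normal N ?S by fact
  interpret Q: group "?S Mod N" by (rule N.factorgroup_is_group)
  have "N #>\<^bsub>?S\<^esub> (x \<otimes> y) = N #>\<^bsub>?S\<^esub> (y \<otimes> x)" if "x \<in> V" "y \<in> V" for x y
  proof (rule sym, rule S.repr_independence)
    show "x \<otimes> y \<in> N #>\<^bsub>?S\<^esub> (y \<otimes> x)"
      using that V by (subst mult_eq_commutator_mult) (auto simp: r_coset_def intro: comm)
  qed (use that N.subgroup_axioms in auto)
  then interpret Q: comm_group "?S Mod N"
    by (intro Q.group_comm_groupI) (auto simp: carrier_FactGroup N.rcos_sum)
  have "dprod_elem_abelian (?S Mod N)"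
  proof (rule Q.dprod_elem_abelianI[OF _ P])
    have "countable V" using V.subset cnt by (rule countable_subset)
    then show "countable (carrier (?S Mod N))" by (simp add: carrier_FactGroup)
  qed (use pow rcoset_pow_eq_one_iff[OF V(1) nV] in \<open>auto simp: carrier_FactGroup\<close>)
  moreover have "N \<lhd> subgroup_generated G (Fitting G)"
    using V N comm by (intro commutator_closed_imp_normal Fitting_subgroup) auto
  ultimately show ?thesis
    unfolding Fcs_admissible_def using N comm by (simp add: commutator_def)
qed

text \<open>The order of a coset divides a squarefree exponent of the quotient and also
  \<open>e\<close>, hence the radical of \<open>e\<close>.\<close>

lemma Fcs_admissible_pow:
  assumes V: "subgroup V G" "V \<subseteq> Fitting G" and adm: "Fcs_admissible G V N"
    and e: "\<And>x. x \<in> V \<Longrightarrow> x [^] (e::nat) \<in> N" "e \<noteq> 0" and x: "x \<in> V"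
  shows "x [^] \<Prod>(prime_factors e) \<in> N"
proof -
  let ?S = "subgroup_generated G V"
  interpret V: subgroup V G by fact
  have nV: "N \<lhd> ?S"
    using V adm unfolding Fcs_admissible_def
    by (intro commutator_closed_imp_normal) (auto simp: commutator_def)
  interpret N: normal N ?S by fact
  interpret Q: group "?S Mod N" by (rule N.factorgroup_is_group)
  let ?y = "N #>\<^bsub>?S\<^esub> x"
  have y: "?y \<in> carrier (?S Mod N)" using x by (simp add: carrier_FactGroup)
  have dp: "dprod_elem_abelian (?S Mod N)" using adm by (simp add: Fcs_admissible_def)
  obtain s :: nat where s: "squarefree s" "\<And>x. x \<in> carrier (?S Mod N) \<Longrightarrow> x [^]\<^bsub>?S Mod N\<^esub> s = \<one>\<^bsub>?S Mod N\<^esub>"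
    using dprod_elem_abelian_exponent[OF Q.is_group dp] by blast
  have "Q.ord ?y dvd s" "Q.ord ?y dvd e"
    using s(2)[OF y] e(1)[OF x] rcoset_pow_eq_one_iff[OF V(1) nV x] Q.pow_eq_id[OF y] by auto
  then have "Q.ord ?y dvd \<Prod>(prime_factors e)"
    using s(1) e(2) squarefree_mono squarefree_dvd_prod_prime_factors by blast
  then show ?thesis
    using rcoset_pow_eq_one_iff[OF V(1) nV x] Q.pow_eq_id[OF y] by blast
qed

text \<open>Every admissible subgroup contains these commutators, so their intersection does too,
  even if the family were empty.\<close>

lemma Fcs_commutator:
  "f \<in> Fitting G \<Longrightarrow> x \<in> Fcs G i \<Longrightarrow> commutator G f x \<in> Fcs G (Suc i)"
  by (auto simp: Fcs_admissible_def commutator_def)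

end

text \<open>Countability instead of finiteness, because the series is also needed in the covering
  group, whose carrier is only shown to be countable.\<close>

locale countable_group = group +
  assumes countable_carrier: "countable (carrier G)"
begin

lemma Fcs_subgroup_subset: "subgroup (Fcs G i) G \<and> Fcs G i \<subseteq> Fitting G \<and>
  (\<forall>f \<in> Fitting G. \<forall>x \<in> Fcs G i. commutator G f x \<in> Fcs G i)"
proof (induction i)
  case 0
  interpret F: subgroup "Fitting G" G by (rule Fitting_subgroup)
  show ?case by (auto simp: Fitting_subgroup commutator_def)
next
  case (Suc i)
  let ?V = "Fcs G i"
  interpret V: subgroup ?V G using Suc by blast
  \<comment> \<open>\<open>?V\<close> is admissible over itself, the trivial quotient having the
    empty product of primes as exponent. So the family is nonempty and its intersection a subgroup
    inside \<open>?V\<close>.\<close>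
  have adm: "Fcs_admissible G ?V ?V"
    by (rule Fcs_admissibleI[OF countable_carrier, where P = "{}"]) (use Suc in auto)
  then have "subgroup (Fcs G (Suc i)) G"
    unfolding Fcs.simps by (intro subgroups_Inter) (auto simp: Fcs_admissible_def)
  moreover have sub: "Fcs G (Suc i) \<subseteq> ?V" using adm by auto
  moreover have "commutator G f x \<in> Fcs G (Suc i)" if "f \<in> Fitting G" "x \<in> Fcs G (Suc i)" for f x
    using Fcs_commutator that sub by blast
  ultimately show ?case using Suc by blast
qed

lemma Fcs_subgroup: "subgroup (Fcs G i) G"
  and Fcs_subset_Fitting: "Fcs G i \<subseteq> Fitting G"
  using Fcs_subgroup_subset by blast+

lemma Fcs_Suc_subset: "Fcs G (Suc i) \<subseteq> Fcs G i"
proof -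
  have "Fcs_admissible G (Fcs G i) (Fcs G i)"
    by (rule Fcs_admissibleI[OF countable_carrier, where P = "{}"])
      (use Fcs_subgroup_subset[of i] subgroup.mem_carrier[OF Fcs_subgroup] in auto)
  then show ?thesis by auto
qed

lemma Fcs_antimono: "i \<le> j \<Longrightarrow> Fcs G j \<subseteq> Fcs G i"
  by (rule lift_Suc_antimono_le[of "Fcs G"]) (rule Fcs_Suc_subset)

text \<open>By \<open>Fcs_commutator\<close> the F-central series is a central series of the Fitting
  subgroup; read upward from its trivial term it stays inside the upper central series.\<close>

lemma F_class_imp_nilpotent:
  assumes "has_F_class G c"
  shows "Fitting G \<subseteq> upper_central G (Fitting G) c"
proof -
  interpret F: subgroup "Fitting G" G by (rule Fitting_subgroup)
  have "Fcs G (c - j) \<subseteq> upper_central G (Fitting G) j" if "j \<le> c" for j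
    using that
  proof (induction j)
    case 0
    then show ?case using assms by (simp add: has_F_class_def)
  next
    case (Suc j)
    interpret U: subgroup "upper_central G (Fitting G) j" G
      by (rule upper_central_subgroup[OF Fitting_subgroup])
    have e: "c - j = Suc (c - Suc j)" using Suc by simp
    have "commutator G x f \<in> upper_central G (Fitting G) j"
      if "x \<in> Fcs G (c - Suc j)" "f \<in> Fitting G" for x f
    proof -
      have x: "x \<in> Fitting G" using that Fcs_subset_Fitting by blast
      have "commutator G f x \<in> upper_central G (Fitting G) j"
        using Fcs_commutator[OF that(2,1)] Suc e by auto
      then have "inv (commutator G f x) \<in> upper_central G (Fitting G) j" by blast
      then show ?thesis using x that by (simp add: inv_commutator)
    qed
    then show ?case using Fcs_subset_Fitting by auto
  qed
  from this[of c] show ?thesis by simp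
qed

end

declare Fcs.simps(2) [simp del]

text \<open>A finite exponent of the Fitting subgroup is what makes the next term of the series
  explicit, through the generators \<open>Fcs_gens\<close>. Finite groups and the covering group
  both satisfy it.\<close>

locale bounded_Fitting = countable_group +
  fixes e :: nat
  assumes e_nonzero: "e \<noteq> 0"
    and Fitting_exponent: "x \<in> Fitting G \<Longrightarrow> x [^] e = \<one>"
begin

abbreviation "r \<equiv> \<Prod>(prime_factors e)"

abbreviation "Fcs_gens V \<equiv> {commutator G f x | f x. f \<in> Fitting G \<and> x \<in> V} \<union> {x [^] r | x. x \<in> V}"

lemma Fcs_gens_subset: "Fcs_gens (Fcs G i) \<subseteq> Fcs G i"
proof -
  interpret V: subgroup "Fcs G i" G by (rule Fcs_subgroup)
  have "x [^] (k::nat) \<in> Fcs G i" if "x \<in> Fcs G i" for x k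
    using that by (induction k) auto
  then show ?thesis using Fcs_subgroup_subset[of i] by auto
qed

lemma Fcs_admissible_generate: "Fcs_admissible G (Fcs G i) (generate G (Fcs_gens (Fcs G i)))"
proof (rule Fcs_admissibleI[OF countable_carrier])
  let ?V = "Fcs G i" and ?N = "generate G (Fcs_gens (Fcs G i))"
  interpret V: subgroup "Fcs G i" G by (rule Fcs_subgroup)
  show "subgroup ?N G" using Fcs_gens_subset[of i] V.subset by (intro generate_is_subgroup) blast
  show "?N \<subseteq> ?V" using Fcs_gens_subset[of i] V.subgroup_axioms by (rule generate_subgroup_incl)
  show "x [^] r \<in> ?N" if "x \<in> ?V" for x using that by (intro generate.incl) blast
  show "commutator G f x \<in> ?N" if "f \<in> Fitting G" "x \<in> ?V" for f x
    using that by (intro generate.incl) blast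
qed (use Fcs_subgroup Fcs_subset_Fitting in auto)

text \<open>The intersection is attained: the generated subgroup is admissible, and every admissible
  subgroup contains the generators, the powers by \<open>Fcs_admissible_pow\<close>.\<close>

lemma Fcs_Suc_eq: "Fcs G (Suc i) = generate G (Fcs_gens (Fcs G i))"
proof
  let ?V = "Fcs G i" and ?N = "generate G (Fcs_gens (Fcs G i))"
  show "Fcs G (Suc i) \<subseteq> ?N"
    using Fcs_admissible_generate[of i] by (auto simp: Fcs.simps(2))
  show "?N \<subseteq> Fcs G (Suc i)"
  proof (rule generate_subgroup_incl[OF _ Fcs_subgroup])
    have "x [^] r \<in> N" if x: "x \<in> ?V" and N: "Fcs_admissible G ?V N" for x N
    proof (rule Fcs_admissible_pow[OF Fcs_subgroup Fcs_subset_Fitting N _ e_nonzero x])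
      have "\<one> \<in> N" using N by (auto simp: Fcs_admissible_def dest: subgroup.one_closed)
      then show "y [^] e \<in> N" if "y \<in> ?V" for y
        using Fitting_exponent[OF subsetD[OF Fcs_subset_Fitting that]] by simp
    qed
    then have "x [^] r \<in> Fcs G (Suc i)" if "x \<in> ?V" for x
      using that by (auto simp: Fcs.simps(2))
    then show "Fcs_gens ?V \<subseteq> Fcs G (Suc i)" using Fcs_commutator by blast
  qed
qed

lemma Fcs_Suc_admissible: "Fcs_admissible G (Fcs G i) (Fcs G (Suc i))"
  using Fcs_admissible_generate[of i] by (simp add: Fcs_Suc_eq)

lemma Fcs_pow_r: "x \<in> Fcs G i \<Longrightarrow> x [^] r \<in> Fcs G (Suc i)"
  unfolding Fcs_Suc_eq by (intro generate.incl) blast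

text \<open>Admissibility only asks for normality in the Fitting subgroup. Normality in
  \<open>G\<close> holds because conjugation permutes the generators of each term.\<close>

lemma Fcs_normal: "Fcs G i \<lhd> G"
proof (induction i)
  case (Suc i)
  interpret V: normal "Fcs G i" G by fact
  interpret F: normal "Fitting G" G by (rule Fitting_normal)
  show ?case
    unfolding Fcs_Suc_eq
  proof (rule normal_generateI)
    fix y a assume y: "y \<in> Fcs_gens (Fcs G i)" and a: "a \<in> carrier G"
    from y consider f x where "y = commutator G f x" "f \<in> Fitting G" "x \<in> Fcs G i"
      | x where "y = x [^] r" "x \<in> Fcs G i" by blast
    then show "a \<otimes> y \<otimes> inv a \<in> Fcs_gens (Fcs G i)"
    proof cases
      case 1
      then show ?thesis
        using a V.inv_op_closed2[OF a] F.inv_op_closed2[OF a] by (auto simp: conj_commutator)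
    next
      case 2
      then show ?thesis
        using a V.inv_op_closed2[OF a] by (auto simp: conj_nat_pow)
    qed
  qed auto
qed (simp add: Fitting_normal)

text \<open>Modulo the next term, \<open>[f, x]\<^sup>k = [f, x\<^sup>k]\<close> and \<open>(x\<^sup>r)\<^sup>k = (x\<^sup>k)\<^sup>r\<close>.\<close>

lemma Fcs_pow_Suc:
  assumes IH: "\<And>x. x \<in> Fcs G i \<Longrightarrow> x [^] (k::nat) \<in> Fcs G (Suc i)"
    and x: "x \<in> Fcs G (Suc i)"
  shows "x [^] k \<in> Fcs G (Suc (Suc i))"
proof -
  let ?V = "Fcs G i" and ?W = "Fcs G (Suc i)" and ?N = "Fcs G (Suc (Suc i))"
  interpret F: subgroup "Fitting G" G by (rule Fitting_subgroup)
  interpret V: normal ?V G by (rule Fcs_normal)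
  interpret W: normal ?W G by (rule Fcs_normal)
  interpret N: normal ?N G by (rule Fcs_normal)
  define Q where "Q = G Mod ?N"
  define \<pi> where "\<pi> = (\<lambda>x. ?N #> x)"
  interpret \<pi>: group_hom G Q \<pi>
    unfolding Q_def \<pi>_def using N.r_coset_hom_Mod N.factorgroup_is_group
    by (intro group_hom.intro group_hom_axioms.intro is_group)
  have ker: "\<pi> x = \<one>\<^bsub>Q\<^esub> \<longleftrightarrow> x \<in> ?N" if "x \<in> carrier G" for x
    using that N.subset coset_join1[OF _ _ N.subgroup_axioms] coset_join2[OF _ N.subgroup_axioms]
    by (auto simp: \<pi>_def Q_def)
  have FG: "x \<in> Fitting G" if "x \<in> Fcs G j" for x j using that Fcs_subset_Fitting by blast
  have central: "\<pi> f \<otimes>\<^bsub>Q\<^esub> \<pi> x = \<pi> x \<otimes>\<^bsub>Q\<^esub> \<pi> f" if "f \<in> Fitting G" "x \<in> ?W" for f x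
  proof -
    have "\<pi> (commutator G f x) = \<one>\<^bsub>Q\<^esub>" using that Fcs_commutator by (subst ker) auto
    then show ?thesis
      using that by (simp add: \<pi>.hom_commutator \<pi>.H.commutator_eq_one_iff)
  qed
  have comm_pow: "\<pi> (commutator G f x [^] j) = \<pi> (commutator G f (x [^] j))"
    if f: "f \<in> Fitting G" and x: "x \<in> ?V" for f x and j :: nat
  proof (induction j)
    case 0
    then show ?case using f by simp
  next
    case (Suc j)
    have xF: "x \<in> Fitting G" using FG[OF x] .
    then have xj: "x [^] j \<in> Fitting G" by (induction j) auto
    let ?c = "commutator G f x" and ?d = "commutator G f (x [^] j)"
    have W: "?c \<in> ?W" using f x by (rule Fcs_commutator)
    have "\<pi> (commutator G f (x [^] Suc j)) = \<pi> (?d \<otimes> (x [^] j \<otimes> ?c \<otimes> inv (x [^] j)))"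
      using f xF xj by (simp add: commutator_mult_right)
    also have "\<dots> = \<pi> ?d \<otimes>\<^bsub>Q\<^esub> (\<pi> (x [^] j) \<otimes>\<^bsub>Q\<^esub> \<pi> ?c \<otimes>\<^bsub>Q\<^esub> inv\<^bsub>Q\<^esub> \<pi> (x [^] j))"
      using f xF xj by simp
    also have "\<dots> = \<pi> ?d \<otimes>\<^bsub>Q\<^esub> \<pi> ?c"
      unfolding central[OF xj W] using f xF xj by (simp add: \<pi>.H.m_assoc)
    also have "\<dots> = \<pi> (?c [^] Suc j)"
      using f xF Suc by simp
    finally show ?case by simp
  qed
  \<comment> \<open>The Fitting subgroup centralises \<open>?W\<close> modulo \<open>?N\<close>, so
    powers of products distribute there. It then suffices to test the generators of
    \<open>?W\<close>.\<close>
  have "subgroup {y \<in> ?W. y [^] k \<in> ?N} G"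
  proof (rule subgroupI)
    have "\<one> \<in> {y \<in> ?W. y [^] k \<in> ?N}" by simp
    then show "{y \<in> ?W. y [^] k \<in> ?N} \<noteq> {}" by blast
  next
    fix y z assume y: "y \<in> {y \<in> ?W. y [^] k \<in> ?N}" and z: "z \<in> {y \<in> ?W. y [^] k \<in> ?N}"
    have "\<pi> ((y \<otimes> z) [^] k) = (\<pi> y \<otimes>\<^bsub>Q\<^esub> \<pi> z) [^]\<^bsub>Q\<^esub> k"
      using y z by (simp add: \<pi>.hom_nat_pow)
    also have "\<dots> = \<pi> y [^]\<^bsub>Q\<^esub> k \<otimes>\<^bsub>Q\<^esub> \<pi> z [^]\<^bsub>Q\<^esub> k"
      using y z FG[of y] by (intro \<pi>.H.pow_mult_distrib central) auto
    also have "\<dots> = \<pi> (y [^] k) \<otimes>\<^bsub>Q\<^esub> \<pi> (z [^] k)"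
      using y z by (simp add: \<pi>.hom_nat_pow)
    also have "\<dots> = \<one>\<^bsub>Q\<^esub>"
      using y z ker[of "y [^] k"] ker[of "z [^] k"] by simp
    finally show "y \<otimes> z \<in> {y \<in> ?W. y [^] k \<in> ?N}"
      using y z ker[of "(y \<otimes> z) [^] k"] by simp
  qed (auto simp: nat_pow_inv)
  moreover have "Fcs_gens ?V \<subseteq> {y \<in> ?W. y [^] k \<in> ?N}"
  proof
    fix y assume "y \<in> Fcs_gens ?V"
    then consider f x where "y = commutator G f x" "f \<in> Fitting G" "x \<in> ?V"
      | x where "y = x [^] r" "x \<in> ?V" by blast
    then show "y \<in> {y \<in> ?W. y [^] k \<in> ?N}"
    proof cases
      case 1
      have "x [^] k \<in> ?W" using IH 1 by blast
      then have "\<pi> (commutator G f (x [^] k)) = \<one>\<^bsub>Q\<^esub>"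
        using 1 Fcs_commutator by (subst ker) auto
      then have "\<pi> (commutator G f x [^] k) = \<one>\<^bsub>Q\<^esub>"
        by (simp only: comm_pow[OF 1(2,3)])
      then show ?thesis using 1 Fcs_commutator by (subst (asm) ker) auto
    next
      case 2
      have "x [^] k \<in> ?W" using IH 2 by blast
      then have "(x [^] k) [^] r \<in> ?N" by (rule Fcs_pow_r)
      then show ?thesis using 2 Fcs_pow_r by (auto simp: nat_pow_pow mult.commute)
    qed
  qed
  ultimately have "generate G (Fcs_gens ?V) \<subseteq> {y \<in> ?W. y [^] k \<in> ?N}"
    by (rule generate_subgroup_incl[rotated])
  then have "?W \<subseteq> {y \<in> ?W. y [^] k \<in> ?N}" by (subst (1) Fcs_Suc_eq)
  then have "x \<in> {y \<in> ?W. y [^] k \<in> ?N}" using x by (rule subsetD)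
  then show ?thesis by simp
qed

text \<open>An exponent of the top factor of the series is an exponent of every factor;
  \<open>kernel_pow\<close> applies this to the last one.\<close>

lemma Fcs_pow:
  assumes "\<And>x. x \<in> Fitting G \<Longrightarrow> x [^] (k::nat) \<in> Fcs G 1" "x \<in> Fcs G i"
  shows "x [^] k \<in> Fcs G (Suc i)"
  using assms(2)
proof (induction i arbitrary: x)
  case 0
  then show ?case using assms(1) by simp
next
  case (Suc i)
  show ?case by (rule Fcs_pow_Suc[OF Suc.IH Suc.prems])
qed

end

text \<open>The image of the Fitting subgroup inherits its exponent, so both series use the same
  radical \<open>r\<close>, and generators map onto generators at each step.\<close>

lemma (in group_hom) image_Fcs:
  assumes B: "bounded_Fitting G e" and C: "countable_group H"
    and im: "h ` Fitting G = Fitting H"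
  shows "h ` Fcs G i = Fcs H i"
proof -
  interpret G: bounded_Fitting G e by (rule B)
  interpret H: countable_group H by (rule C)
  have "bounded_Fitting H e"
  proof (intro bounded_Fitting.intro bounded_Fitting_axioms.intro C)
    fix x assume "x \<in> Fitting H"
    then obtain y where y: "y \<in> Fitting G" "x = h y" using im by blast
    interpret F: subgroup "Fitting G" G by (rule G.Fitting_subgroup)
    show "x [^]\<^bsub>H\<^esub> e = \<one>\<^bsub>H\<^esub>"
      using y hom_nat_pow[of y e] by (simp add: G.Fitting_exponent)
  qed (rule G.e_nonzero)
  interpret H: bounded_Fitting H e by fact
  show ?thesis
  proof (induction i)
    case (Suc i)
    have F: "Fitting G \<subseteq> carrier G" and V: "Fcs G i \<subseteq> carrier G"
      using G.Fitting_subgroup G.Fcs_subgroup by (simp_all add: subgroup.subset)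
    let ?C = "(\<lambda>(f, x). commutator G f x) ` (Fitting G \<times> Fcs G i)"
      and ?P = "(\<lambda>x. x [^] G.r) ` Fcs G i"
    have gens: "G.Fcs_gens (Fcs G i) = ?C \<union> ?P"
      by auto
    have "h ` ?C = (\<lambda>(f, x). commutator H f x) ` (h ` Fitting G \<times> h ` Fcs G i)"
      using F V by (force simp: hom_commutator image_iff subset_iff)
    moreover have "h ` ?P = (\<lambda>x. x [^]\<^bsub>H\<^esub> G.r) ` h ` Fcs G i"
      unfolding image_image using V by (intro image_cong refl hom_nat_pow) auto
    moreover have "H.Fcs_gens (h ` Fcs G i) = (\<lambda>(f, x). commutator H f x) ` (Fitting H \<times> h ` Fcs G i)
        \<union> (\<lambda>x. x [^]\<^bsub>H\<^esub> G.r) ` h ` Fcs G i"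
      by auto
    ultimately have "h ` G.Fcs_gens (Fcs G i) = H.Fcs_gens (h ` Fcs G i)"
      unfolding gens image_Un im by simp
    moreover have "G.Fcs_gens (Fcs G i) \<subseteq> carrier G" using G.Fcs_gens_subset V by (rule order_trans)
    then have "h ` Fcs G (Suc i) = generate H (h ` G.Fcs_gens (Fcs G i))"
      unfolding G.Fcs_Suc_eq by (rule generate_img[symmetric])
    ultimately show ?case
      by (simp only: H.Fcs_Suc_eq Suc[symmetric])
  qed (simp add: im)
qed

section \<open>Fitting subgroup, generation and exponent for a descendant over its quotient\<close>

section \<open>Extensions by the last term of the series\<close>

text \<open>In the application the locale's \<open>G\<close> is the descendant, its \<open>H\<close>
  the given group, \<open>h\<close> the projection, and \<open>Suc b\<close> the class of the given
  group.\<close>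

locale F_extension = group_hom G H h + G: bounded_Fitting G e + H: countable_group H
  for G (structure) and H (structure) and h and e +
  fixes b m :: nat
  assumes surj: "h ` carrier G = carrier H"
    and kernel_eq: "kernel G H h = Fcs G (Suc b)"
    and Fcs_trivial: "Fcs G (Suc (Suc b)) = {\<one>}"
    and nilpotent: "Fitting H \<subseteq> upper_central H (Fitting H) m"
begin

text \<open>The goal is \<open>A = Fitting G\<close>. \<open>P_A\<close> is the easy inclusion; the
  other one needs \<open>Z\<close> inside the upper central series of \<open>A\<close>.\<close>

definition "A = {x \<in> carrier G. h x \<in> Fitting H}"

abbreviation "P \<equiv> Fitting G"
abbreviation "V \<equiv> Fcs G b"
abbreviation "Z \<equiv> Fcs G (Suc b)"
abbreviation "U \<equiv> upper_central G A"
abbreviation "W \<equiv> upper_central H (Fitting H)"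

sublocale P: normal P G by (rule G.Fitting_normal)
sublocale V: normal V G by (rule G.Fcs_normal)
sublocale Z: normal Z G by (rule G.Fcs_normal)

lemma A_subgroup: "subgroup A G"
proof -
  interpret N: subgroup "Fitting H" H by (rule H.Fitting_subgroup)
  show ?thesis unfolding A_def by (rule G.subgroupI) auto
qed

sublocale A: subgroup A G by (rule A_subgroup)

lemma U_subgroup: "subgroup (U j) G" by (rule G.upper_central_subgroup[OF A_subgroup])

lemma U_mono: "i \<le> j \<Longrightarrow> x \<in> U i \<Longrightarrow> x \<in> U j"
  using G.upper_central_mono[OF A_subgroup] by blast

lemma Z_V: "x \<in> Z \<Longrightarrow> x \<in> V"
  by (rule subsetD[OF G.Fcs_Suc_subset])

lemma V_P: "x \<in> V \<Longrightarrow> x \<in> P"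
  by (rule subsetD[OF G.Fcs_subset_Fitting])

lemma P_A: "x \<in> P \<Longrightarrow> x \<in> A"
  using subsetD[OF image_Fitting_subset[OF surj] imageI[of x P h]] unfolding A_def by simp

lemma A_Fitting: "x \<in> A \<Longrightarrow> h x \<in> Fitting H"
  unfolding A_def by simp

lemma Z_iff: "x \<in> carrier G \<Longrightarrow> x \<in> Z \<longleftrightarrow> h x = \<one>\<^bsub>H\<^esub>"
  unfolding kernel_eq[symmetric] kernel_def by simp

lemma Z_central:
  assumes "x \<in> P" "z \<in> Z" shows "x \<otimes> z = z \<otimes> x"
proof -
  have "commutator G x z = \<one>" using G.Fcs_commutator[OF assms] Fcs_trivial by simp
  then show ?thesis using assms by (simp add: G.commutator_eq_one_iff)
qed

lemma Z_pow_r: "z \<in> Z \<Longrightarrow> z [^] G.r = \<one>"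
  using G.Fcs_pow_r[of z "Suc b"] Fcs_trivial by simp

lemma commutator_in_Z: "x \<in> P \<Longrightarrow> v \<in> V \<Longrightarrow> commutator G x v \<in> Z"
  by (rule G.Fcs_commutator)

lemma conj_central:
  assumes "x \<in> P" "z \<in> Z" shows "x \<otimes> z \<otimes> inv x = z"
  unfolding Z_central[OF assms] using assms by (simp add: G.m_assoc)

text \<open>The conjugation in \<open>commutator_mult_left\<close> disappears because commutators
  with \<open>V\<close> lie in \<open>Z\<close>, which \<open>P\<close> centralises.\<close>

lemma commutator_left_additive:
  assumes "x \<in> P" "y \<in> P" "v \<in> V"
  shows "commutator G (x \<otimes> y) v = commutator G y v \<otimes> commutator G x v"
  using assms conj_central[OF assms(1) commutator_in_Z[OF assms(2,3)]]
  by (simp add: G.commutator_mult_left)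

lemma commutator_right_additive:
  assumes "x \<in> P" "u \<in> V" "v \<in> V"
  shows "commutator G x (u \<otimes> v) = commutator G x u \<otimes> commutator G x v"
  using assms conj_central[OF V_P[OF assms(2)] commutator_in_Z[OF assms(1,3)]]
  by (simp add: G.commutator_mult_right)

lemma commutator_in_normal:
  assumes "a \<in> carrier G" "N \<lhd> G" "x \<in> N"
  shows "commutator G a x \<in> N"
proof -
  interpret N: normal N G by fact
  show ?thesis unfolding commutator_def using assms N.inv_op_closed2 by auto
qed

lemma commutator_A_descends:
  assumes "a \<in> A" "x \<in> A" "h x \<in> W (Suc j)"
  shows "h (commutator G a x) \<in> W j"
proof -
  interpret W: subgroup "W j" H by (rule H.upper_central_subgroup[OF H.Fitting_subgroup])
  have "commutator H (h x) (h a) \<in> W j" using assms A_Fitting by simp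
  then have "inv\<^bsub>H\<^esub> (commutator H (h x) (h a)) \<in> W j" by (rule W.m_inv_closed)
  then show ?thesis using assms by (simp add: hom_commutator H.inv_commutator)
qed

lemma U_SucI:
  assumes "x \<in> A" "\<And>a. a \<in> A \<Longrightarrow> commutator G a x \<in> U j"
  shows "x \<in> U (Suc j)"
proof -
  interpret U: subgroup "U j" G by (rule U_subgroup)
  have "commutator G x a \<in> U j" if "a \<in> A" for a
    using U.m_inv_closed[OF assms(2)[OF that]] assms(1) that by (simp add: G.inv_commutator)
  then show ?thesis using assms(1) by simp
qed

text \<open>With \<open>W\<close> pulled back to \<open>A\<close>, commutation \<open>P \<times> V \<rightarrow> Z\<close> is bilinear and conjugation by \<open>A\<close>
  moves each argument only by elements lying deeper in \<open>W\<close>; hence the weights add.\<close>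

lemma commutator_in_U:
  assumes "p \<in> P" "v \<in> V" "h p \<in> W i" "h v \<in> W j"
  shows "commutator G p v \<in> U (i + j)"
  using assms
proof (induction "i + j" arbitrary: i j p v rule: less_induct)
  case less
  interpret U: subgroup "U n" G for n by (rule U_subgroup)
  note pv = less.prems(1,2)
  show ?case
  proof (cases "i = 0 \<or> j = 0")
    case True
    \<comment> \<open>\<open>W 0\<close> is trivial, so an argument of weight 0 lies in the kernel
      \<open>Z\<close> and commutes with the other one.\<close>
    then have "p \<in> Z \<or> v \<in> Z" using less.prems Z_iff[of p] Z_iff[of v] by auto
    then have "commutator G p v = \<one>"
      using Z_central[of p v] Z_central[of v p] pv V_P[of v] by (auto simp: G.commutator_eq_one_iff)
    then show ?thesis by simp
  next
    case False
    then obtain i' j' where ij: "i = Suc i'" "j = Suc j'" by (meson not0_implies_Suc)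
    let ?w = "commutator G p v"
    have wZ: "?w \<in> Z" using pv by (rule commutator_in_Z)
    have "?w \<in> U (Suc (i' + j))"
    proof (rule U_SucI)
      show "?w \<in> A" using wZ by (intro P_A V_P Z_V)
    next
      fix a assume a: "a \<in> A"
      let ?p = "commutator G a p" and ?v = "commutator G a v"
      have p': "?p \<in> P" "h ?p \<in> W i'"
        using a pv less.prems(3) ij P_A
        by (auto intro: commutator_in_normal[OF _ P.normal_axioms] commutator_A_descends)
      have v': "?v \<in> V" "h ?v \<in> W j'"
        using a pv less.prems(4) ij P_A V_P
        by (auto intro: commutator_in_normal[OF _ V.normal_axioms] commutator_A_descends)
      let ?\<alpha> = "commutator G p ?v" and ?\<beta> = "commutator G ?p ?v" and ?\<gamma> = "commutator G ?p v"
      have abcZ: "?\<alpha> \<in> Z" "?\<beta> \<in> Z" "?\<gamma> \<in> Z" using pv p' v' by (auto intro: commutator_in_Z)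
      have bcw: "?\<beta> \<otimes> ?\<gamma> \<otimes> ?w = ?w \<otimes> (?\<beta> \<otimes> ?\<gamma>)"
        using abcZ wZ by (intro Z_central) (auto intro: V_P Z_V)
      \<comment> \<open>Conjugation by \<open>a\<close> multiplies each argument by its commutator
        with \<open>a\<close>; bilinearity expands the result into \<open>?w\<close> and three
        correction terms.\<close>
      have "a \<otimes> ?w \<otimes> inv a = commutator G (?p \<otimes> p) (?v \<otimes> v)"
        using a pv by (subst G.conj_commutator) (simp_all add: G.conj_eq_commutator_mult)
      also have "\<dots> = (?\<alpha> \<otimes> ?w) \<otimes> (?\<beta> \<otimes> ?\<gamma>)"
        using pv p' v'
        by (simp only: commutator_left_additive V.m_closed)
          (simp only: commutator_right_additive)
      also have "\<dots> = ?\<alpha> \<otimes> (?w \<otimes> (?\<beta> \<otimes> ?\<gamma>))"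
        using abcZ wZ by (simp add: G.m_assoc)
      also have "\<dots> = ?\<alpha> \<otimes> (?\<beta> \<otimes> ?\<gamma> \<otimes> ?w)"
        by (simp only: bcw)
      finally have "commutator G a ?w \<otimes> ?w = ?\<alpha> \<otimes> (?\<beta> \<otimes> ?\<gamma>) \<otimes> ?w"
        using a wZ abcZ by (simp add: G.m_assoc flip: G.conj_eq_commutator_mult)
      then have eq: "commutator G a ?w = ?\<alpha> \<otimes> (?\<beta> \<otimes> ?\<gamma>)"
        using a wZ abcZ by simp
      \<comment> \<open>Since \<open>i + j' = i' + j\<close>, none of the three weights exceeds
        \<open>i' + j\<close>.\<close>
      have "?\<alpha> \<in> U (i + j')" using less.hyps[of i j' p ?v] pv v' less.prems ij by simp
      moreover have "?\<beta> \<in> U (i' + j')" using less.hyps[of i' j' ?p ?v] p' v' ij by simp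
      moreover have "?\<gamma> \<in> U (i' + j)" using less.hyps[of i' j ?p v] p' pv less.prems ij by simp
      ultimately have "?\<alpha> \<in> U (i' + j)" "?\<beta> \<in> U (i' + j)" "?\<gamma> \<in> U (i' + j)"
        using ij by (auto elim: U_mono[rotated] simp del: upper_central.simps)
      then show "commutator G a ?w \<in> U (i' + j)" unfolding eq by (intro U.m_closed)
    qed
    then show ?thesis using ij by simp
  qed
qed

lemma h_W: "x \<in> P \<Longrightarrow> h x \<in> W m"
  using nilpotent image_Fitting_subset[OF surj] by blast

text \<open>Collecting powers costs only commutators of elements of \<open>V\<close>. They lie in
  \<open>Z\<close> and, by \<open>commutator_in_U\<close> with both weights \<open>m\<close>, in
  \<open>U (m + m)\<close>.\<close>

lemma V_pow_mult:
  assumes x: "x \<in> V" and y: "y \<in> V"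
  shows "\<exists>d \<in> Z \<inter> U (m + m). (x \<otimes> y) [^] (k::nat) = d \<otimes> (x [^] k \<otimes> y [^] k)"
proof (induction k)
  case 0
  interpret U: subgroup "U n" G for n by (rule U_subgroup)
  show ?case by (intro bexI[of _ \<one>]) auto
next
  case (Suc k)
  interpret U: subgroup "U n" G for n by (rule U_subgroup)
  obtain d where d: "d \<in> Z" "d \<in> U (m + m)" "(x \<otimes> y) [^] k = d \<otimes> (x [^] k \<otimes> y [^] k)"
    using Suc by blast
  have pV: "x [^] k \<in> V" "y [^] k \<in> V" using x y by (induction k) auto
  let ?c = "commutator G (y [^] k) x"
  have cZ: "?c \<in> Z" using pV x by (intro commutator_in_Z V_P)
  have cU: "?c \<in> U (m + m)" using pV x by (intro commutator_in_U h_W V_P)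
  have "(x \<otimes> y) [^] Suc k = d \<otimes> (x [^] k \<otimes> (y [^] k \<otimes> x) \<otimes> y)"
    using d x y by (simp add: G.m_assoc)
  also have "y [^] k \<otimes> x = ?c \<otimes> (x \<otimes> y [^] k)"
    using x y by (intro G.mult_eq_commutator_mult) auto
  also have "d \<otimes> (x [^] k \<otimes> (?c \<otimes> (x \<otimes> y [^] k)) \<otimes> y) = d \<otimes> ((x [^] k \<otimes> ?c) \<otimes> (x \<otimes> y [^] k \<otimes> y))"
    using d(1) x y by (simp add: G.m_assoc)
  also have "x [^] k \<otimes> ?c = ?c \<otimes> x [^] k"
    using pV cZ by (intro Z_central V_P)
  also have "d \<otimes> (?c \<otimes> x [^] k \<otimes> (x \<otimes> y [^] k \<otimes> y)) = (d \<otimes> ?c) \<otimes> (x [^] Suc k \<otimes> y [^] Suc k)"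
    using d(1) x y by (simp add: G.m_assoc)
  finally show ?case
    using d cZ cU by (intro bexI[of _ "d \<otimes> ?c"]) auto
qed

text \<open>Taking \<open>r\<close>-th powers in \<open>a v a^-1 = [a, v] v\<close> gives
  \<open>[a, v^r] = d [a, v]^r\<close> with \<open>d\<close> from \<open>V_pow_mult\<close>, and
  \<open>[a, v]\<close> has smaller weight. At weight 0, \<open>v\<close> lies in \<open>Z\<close>
  and its \<open>r\<close>-th power is trivial.\<close>

lemma pow_in_U:
  assumes "v \<in> V" "h v \<in> W j"
  shows "v [^] G.r \<in> U (m + m + j)"
  using assms
proof (induction j arbitrary: v)
  case 0
  interpret U: subgroup "U n" G for n by (rule U_subgroup)
  have "v \<in> Z" using 0 by (subst Z_iff) auto
  then show ?case by (simp add: Z_pow_r)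
next
  case (Suc j)
  interpret U: subgroup "U n" G for n by (rule U_subgroup)
  have vr: "v [^] G.r \<in> Z" using Suc.prems by (intro G.Fcs_pow_r)
  have "v [^] G.r \<in> U (Suc (m + m + j))"
  proof (rule U_SucI)
    show "v [^] G.r \<in> A" using vr by (intro P_A V_P Z_V)
  next
    fix a assume a: "a \<in> A"
    let ?v = "commutator G a v"
    have v': "?v \<in> V" "h ?v \<in> W j"
      using a Suc.prems P_A V_P
      by (auto intro: commutator_in_normal[OF _ V.normal_axioms] commutator_A_descends)
    obtain d where d: "d \<in> Z" "d \<in> U (m + m)"
      "(?v \<otimes> v) [^] G.r = d \<otimes> (?v [^] G.r \<otimes> v [^] G.r)"
      using V_pow_mult[OF v'(1) Suc.prems(1)] by blast
    have "commutator G a (v [^] G.r) \<otimes> v [^] G.r = a \<otimes> v [^] G.r \<otimes> inv a"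
      using a Suc.prems by (intro G.conj_eq_commutator_mult[symmetric]) auto
    also have "\<dots> = (a \<otimes> v \<otimes> inv a) [^] G.r"
      using a Suc.prems by (intro G.conj_nat_pow) auto
    also have "a \<otimes> v \<otimes> inv a = ?v \<otimes> v"
      using a Suc.prems by (intro G.conj_eq_commutator_mult) auto
    also have "(?v \<otimes> v) [^] G.r = (d \<otimes> ?v [^] G.r) \<otimes> v [^] G.r"
      using d(1,3) a Suc.prems by (simp add: G.m_assoc)
    finally have eq: "commutator G a (v [^] G.r) = d \<otimes> ?v [^] G.r"
      using d(1) a Suc.prems by simp
    have "d \<in> U (m + m + j)" using U_mono[OF _ d(2)] by simp
    then show "commutator G a (v [^] G.r) \<in> U (m + m + j)"
      unfolding eq using Suc.IH[OF v'] by (rule U.m_closed)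
  qed
  then show ?case by simp
qed

text \<open>Checked on the generators of \<open>Z\<close>: every element of \<open>P\<close> has
  weight \<open>m\<close> by nilpotency of the quotient's Fitting subgroup.\<close>

lemma Z_subset_U: "Z \<subseteq> U (m + m + m)"
proof -
  have "commutator G f x \<in> U (m + m + m)" if "f \<in> P" "x \<in> V" for f x
    using U_mono[OF _ commutator_in_U[OF that h_W h_W]] that V_P by simp
  moreover have "x [^] G.r \<in> U (m + m + m)" if "x \<in> V" for x
    using that V_P h_W by (intro pow_in_U) auto
  ultimately show ?thesis
    unfolding G.Fcs_Suc_eq by (intro G.generate_subgroup_incl U_subgroup) auto
qed

lemma Fitting_vimage: "Fitting G = {x \<in> carrier G. h x \<in> Fitting H}"
  using Z_subset_U kernel_eq unfolding A_def
  by (intro Fitting_eq_vimage[OF surj nilpotent]) auto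

lemma Fitting_image: "h ` Fitting G = Fitting H"
proof -
  have "Fitting H \<subseteq> h ` carrier G" using surj H.Fitting_subgroup subgroup.subset by blast
  then show ?thesis unfolding Fitting_vimage by auto
qed

text \<open>\<open>Z\<close> behaves like a Frattini part. Its generators do not change when their
  entries are altered by elements of \<open>Z\<close>, which \<open>P\<close> centralises and whose
  \<open>r\<close>-th powers vanish; so entries may be chosen in \<open>S\<close>, whence
  \<open>S\<close> contains \<open>Z\<close>.\<close>

lemma subgroup_eq_carrier:
  assumes S: "subgroup S G" and im: "carrier H \<subseteq> h ` S"
  shows "S = carrier G"
proof -
  interpret S: subgroup S G by fact
  have decomp: "\<exists>s \<in> S. \<exists>z \<in> Z. x = s \<otimes> z" if x: "x \<in> carrier G" for x
  proof -
    have "h x \<in> h ` S" using im hom_closed[OF x] by (rule subsetD)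
    then obtain s where s: "s \<in> S" "h s = h x" by (metis imageE)
    then have "inv s \<otimes> x \<in> Z" using x by (subst Z_iff) auto
    moreover have "x = s \<otimes> (inv s \<otimes> x)" using s x by (simp add: G.inv_mult_cancel)
    ultimately show ?thesis using s by blast
  qed
  have factor_P: "s \<in> P" if "s \<otimes> z \<in> P" "s \<in> S" "z \<in> Z" for s z
  proof -
    have "inv z \<in> P" using that by (intro P.m_inv_closed V_P Z_V)
    with that(1) have "(s \<otimes> z) \<otimes> inv z \<in> P" by (rule P.m_closed)
    then show ?thesis using that by (simp add: G.m_assoc)
  qed
  have "Z \<subseteq> S"
    unfolding G.Fcs_Suc_eq
  proof (rule G.generate_subgroup_incl[OF _ S], rule subsetI)
    fix y assume "y \<in> G.Fcs_gens V"
    then consider f x where "y = commutator G f x" "f \<in> P" "x \<in> V"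
      | x where "y = x [^] G.r" "x \<in> V" by blast
    then show "y \<in> S"
    proof cases
      case 1
      obtain s z where s: "s \<in> S" "z \<in> Z" "f = s \<otimes> z" using decomp[OF P.mem_carrier[OF 1(2)]] by blast
      obtain t w where t: "t \<in> S" "w \<in> Z" "x = t \<otimes> w" using decomp[OF V.mem_carrier[OF 1(3)]] by blast
      have P: "s \<in> P" "t \<in> P" "z \<in> P" "w \<in> P"
        using factor_P[of s z] factor_P[of t w] s t 1 V_P[OF 1(3)] V_P[OF Z_V] by blast+
      have tV: "t \<in> V"
      proof -
        have "t = x \<otimes> inv w" using t by (simp add: G.m_assoc)
        then show ?thesis using 1 Z_V[OF t(2)] by simp
      qed
      have "commutator G z x = \<one>" "commutator G s w = \<one>"
        using s(2) t(2) P V_P[OF 1(3)] Z_central[of x z] Z_central[of s w]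
        by (simp_all add: G.commutator_eq_one_iff)
      moreover have "y = commutator G z x \<otimes> commutator G s x"
        unfolding 1(1) s(3) using P 1(3) by (intro commutator_left_additive)
      moreover have "commutator G s x = commutator G s t \<otimes> commutator G s w"
        unfolding t(3) using P(1) tV Z_V[OF t(2)] by (intro commutator_right_additive)
      ultimately have "y = commutator G s t" using P by simp
      then show ?thesis using s t by (simp add: commutator_def)
    next
      case 2
      obtain t w where t: "t \<in> S" "w \<in> Z" "x = t \<otimes> w" using decomp[OF V.mem_carrier[OF 2(2)]] by blast
      have "t \<in> P" using factor_P[of t w] t V_P[OF 2(2)] by blast
      then have "(t \<otimes> w) [^] G.r = t [^] G.r \<otimes> w [^] G.r"
        using t by (intro G.pow_mult_distrib Z_central) auto
      then have "y = t [^] G.r \<otimes> w [^] G.r"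
        using 2 t by simp
      also have "\<dots> = t [^] G.r" using t by (simp add: Z_pow_r)
      finally have "y = t [^] G.r" .
      moreover have "t [^] k \<in> S" for k :: nat using t by (induction k) auto
      ultimately show ?thesis by simp
    qed
  qed
  then have "x \<in> S" if "x \<in> carrier G" for x
    using decomp[OF that] S.m_closed by blast
  then show ?thesis using S.subset by blast
qed

text \<open>An exponent of the top factor of the quotient's series lifts to the top factor upstairs,
  since \<open>Z\<close> lies in \<open>Fcs G 1\<close>. Then \<open>Fcs_pow\<close> carries it down
  to \<open>Z\<close> itself.\<close>

lemma kernel_pow:
  assumes k: "\<And>y. y \<in> Fitting H \<Longrightarrow> y [^]\<^bsub>H\<^esub> (k::nat) \<in> Fcs H 1" and z: "z \<in> kernel G H h"
  shows "z [^] k = \<one>"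
proof -
  have img: "h ` Fcs G 1 = Fcs H 1"
    by (rule image_Fcs[OF G.bounded_Fitting_axioms H.countable_group_axioms Fitting_image])
  interpret F1: subgroup "Fcs G 1" G by (rule G.Fcs_subgroup)
  \<comment> \<open>The index \<open>Suc b\<close> is positive, so correcting by an element of
    \<open>Z\<close> does not leave \<open>Fcs G 1\<close>.\<close>
  have Z1: "Z \<subseteq> Fcs G 1" by (rule G.Fcs_antimono) simp
  have "x [^] k \<in> Fcs G 1" if x: "x \<in> Fitting G" for x
  proof -
    have "h x [^]\<^bsub>H\<^esub> k \<in> h ` Fcs G 1"
      unfolding img using x Fitting_image by (intro k) blast
    then have "h (x [^] k) \<in> h ` Fcs G 1" using x by (simp add: hom_nat_pow)
    then obtain u where u: "u \<in> Fcs G 1" "h (x [^] k) = h u" by blast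
    then have "inv u \<otimes> x [^] k \<in> Z" using x by (subst Z_iff) auto
    then have "u \<otimes> (inv u \<otimes> x [^] k) \<in> Fcs G 1" using u Z1 by blast
    then show ?thesis using u x by (simp add: G.inv_mult_cancel)
  qed
  then have "z [^] k \<in> Fcs G (Suc (Suc b))"
    using z unfolding kernel_eq by (rule G.Fcs_pow)
  then show ?thesis by (simp add: Fcs_trivial)
qed

end

section \<open>Reduced words: the group laws by van der Waerden's method\<close>

section \<open>Free groups\<close>

lemma free_reduce_Nil [simp]: "free_reduce [] = []"
  by (simp add: free_reduce_def)

lemma free_reduce_Cons [simp]: "free_reduce (a # w) = red_step a (free_reduce w)"
  by (simp add: free_reduce_def)

lemma free_reduce_append: "free_reduce (u @ v) = foldr red_step u (free_reduce v)"
  by (simp add: free_reduce_def)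

lemma length_red_step: "length (red_step a w) \<le> Suc (length w)"
  by (auto simp: red_step_def split: list.split)

lemma length_free_reduce: "length (free_reduce w) \<le> length w"
  by (induction w) (auto intro: order_trans[OF length_red_step])

lemma set_red_step: "set (red_step a w) \<subseteq> insert a (set w)"
  by (auto simp: red_step_def split: list.split)

lemma set_free_reduce: "set (free_reduce w) \<subseteq> set w"
  using set_red_step by (induction w) fastforce+

lemma reduced_tl:
  assumes "free_reduce (a # w) = a # w"
  shows "free_reduce w = w" "red_step a w = a # w"
proof -
  show "free_reduce w = w"
  proof (cases "free_reduce w")
    case Nil
    then show ?thesis using assms by (simp add: red_step_def)
  next
    case (Cons b rest)
    \<comment> \<open>Cancellation against \<open>b\<close> would produce a word too short to equal
      \<open>a # w\<close>.\<close>
    have "rest \<noteq> a # w" using length_free_reduce[of w] unfolding Cons by auto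
    then have "red_step a (free_reduce w) = a # free_reduce w"
      using assms unfolding free_reduce_Cons Cons red_step_def by (simp split: if_splits)
    then show ?thesis using assms by simp
  qed
  then show "red_step a w = a # w" using assms by simp
qed

lemma reduced_red_step:
  assumes w: "free_reduce w = w"
  shows "free_reduce (red_step a w) = red_step a w"
proof -
  have "red_step a w = a # w \<or> (\<exists>b. w = b # red_step a w)"
    by (auto simp: red_step_def split: list.split)
  then show ?thesis
  proof
    assume *: "red_step a w = a # w"
    show ?thesis by (subst *) (simp add: w)
  next
    assume "\<exists>b. w = b # red_step a w"
    then show ?thesis using reduced_tl(1) w by metis
  qed
qed

lemma reduced_free_reduce [simp]: "free_reduce (free_reduce w) = free_reduce w"
  by (induction w) (auto simp: reduced_red_step)

lemma reduced_foldr_red_step: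
  "free_reduce z = z \<Longrightarrow> free_reduce (foldr red_step u z) = foldr red_step u z"
  by (induction u) (auto simp: reduced_red_step)

text \<open>Letters act on reduced words through \<open>red_step\<close>, opposite letters by
  mutually inverse maps; the group laws are read off from this action.\<close>

lemma red_step_inverse:
  assumes w: "free_reduce w = w" and ab: "fst a = fst b" "snd a \<noteq> snd b"
  shows "red_step a (red_step b w) = w"
proof (cases w)
  case (Cons d rest)
  show ?thesis
  proof (cases "fst b = fst d \<and> snd b \<noteq> snd d")
    case True
    then have "d = a" using ab by (auto simp: prod_eq_iff)
    moreover have "red_step b w = rest" using True Cons by (simp add: red_step_def)
    ultimately show ?thesis using reduced_tl(2)[of a rest] w Cons by simp
  next
    case False
    then have "red_step b w = b # w" using Cons by (auto simp: red_step_def)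
    then show ?thesis using ab by (simp add: red_step_def)
  qed
qed (use ab in \<open>simp add: red_step_def\<close>)

lemma foldr_red_step_red_step:
  assumes "free_reduce z = z"
  shows "foldr red_step (red_step a v) z = red_step a (foldr red_step v z)"
proof (cases v)
  case (Cons b rest)
  then show ?thesis
    using red_step_inverse[OF reduced_foldr_red_step[OF assms], of a b rest]
    by (auto simp: red_step_def[of a "b # rest"])
qed (simp add: red_step_def)

text \<open>A word and its reduced form act alike, so reduction may be omitted inside a product;
  this yields associativity.\<close>

lemma foldr_red_step_free_reduce:
  "free_reduce z = z \<Longrightarrow> foldr red_step (free_reduce u) z = foldr red_step u z"
  by (induction u) (simp_all add: foldr_red_step_red_step)

lemma free_reduce_append_left [simp]: "free_reduce (free_reduce u @ v) = free_reduce (u @ v)"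
  by (simp add: free_reduce_append foldr_red_step_free_reduce)

lemma free_reduce_append_right [simp]: "free_reduce (u @ free_reduce v) = free_reduce (u @ v)"
  by (simp add: free_reduce_append)

abbreviation word_inv :: "word \<Rightarrow> word" where
  "word_inv w \<equiv> rev (map (\<lambda>(i, b). (i, \<not> b)) w)"

lemma foldr_red_step_word_inv:
  "free_reduce z = z \<Longrightarrow> foldr red_step (word_inv u) (foldr red_step u z) = z"
  by (induction u) (auto simp: red_step_inverse reduced_foldr_red_step split: prod.split)

lemma free_reduce_word_inv: "free_reduce (word_inv w @ w) = []"
  using foldr_red_step_word_inv[of "[]" w] by (simp add: free_reduce_append, simp add: free_reduce_def)

lemma group_free_group: "group (free_group n)"
proof (rule groupI)
  fix x assume "x \<in> carrier (free_group n)"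
  then show "\<exists>y\<in>carrier (free_group n). y \<otimes>\<^bsub>free_group n\<^esub> x = \<one>\<^bsub>free_group n\<^esub>"
    using set_free_reduce[of "word_inv x"]
    by (intro bexI[of _ "free_reduce (word_inv x)"])
      (fastforce simp: free_group_def free_reduce_word_inv)+
next
  fix x y assume "x \<in> carrier (free_group n)" "y \<in> carrier (free_group n)"
  then show "x \<otimes>\<^bsub>free_group n\<^esub> y \<in> carrier (free_group n)"
    using set_free_reduce[of "x @ y"] by (auto simp: free_group_def)
qed (auto simp: free_group_def)

section \<open>Evaluation of words in a group\<close>

context group
begin

lemma word_eval_Cons [simp]:
  "word_eval G g ((i, b) # w) = (if b then g i else inv (g i)) \<otimes> word_eval G g w"
  by (simp add: word_eval_def)

lemma word_eval_Nil [simp]: "word_eval G g [] = \<one>"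
  by (simp add: word_eval_def)

lemma word_eval_cong:
  assumes "\<And>i. i < n \<Longrightarrow> f i = g i" "\<And>x. x \<in> set w \<Longrightarrow> fst x < n"
  shows "word_eval G f w = word_eval G g w"
  using assms(2)
proof (induction w)
  case (Cons a w)
  then show ?case using assms(1)[of "fst a"] Cons.prems[of a] by (cases a) simp
qed simp

lemma word_eval_closed:
  assumes "g ` {..<n} \<subseteq> carrier G" "\<And>x. x \<in> set w \<Longrightarrow> fst x < n"
  shows "word_eval G g w \<in> carrier G"
  using assms(2)
proof (induction w)
  case (Cons a w)
  have "g (fst a) \<in> carrier G" using Cons.prems[of a] assms(1) by (simp add: image_subset_iff)
  then show ?case using Cons by (cases a) auto
qed simp

lemma word_eval_append:
  assumes "g ` {..<n} \<subseteq> carrier G" "\<And>x. x \<in> set u \<union> set v \<Longrightarrow> fst x < n"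
  shows "word_eval G g (u @ v) = word_eval G g u \<otimes> word_eval G g v"
  using assms(2)
proof (induction u)
  case Nil
  then show ?case using word_eval_closed[OF assms(1), of v] by simp
next
  case (Cons a u)
  have "g (fst a) \<in> carrier G" using Cons.prems[of a] assms(1) by (simp add: image_subset_iff)
  moreover have "word_eval G g u \<in> carrier G" "word_eval G g v \<in> carrier G"
    using Cons.prems by (auto intro!: word_eval_closed[OF assms(1)])
  ultimately show ?case using Cons by (cases a) (auto simp: m_assoc)
qed

lemma word_eval_red_step:
  assumes "g ` {..<n} \<subseteq> carrier G" "\<And>x. x \<in> set (a # w) \<Longrightarrow> fst x < n"
  shows "word_eval G g (red_step a w) = word_eval G g (a # w)"
proof (cases w)
  case (Cons b rest)
  have "g (fst a) \<in> carrier G" using assms(2)[of a] assms(1) by (simp add: image_subset_iff)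
  moreover have "word_eval G g rest \<in> carrier G"
    using assms(2) Cons by (intro word_eval_closed[OF assms(1)]) auto
  ultimately show ?thesis
    using Cons by (cases a; cases b) (auto simp: red_step_def inv_mult_cancel)
qed (simp add: red_step_def)

lemma word_eval_free_reduce:
  assumes "g ` {..<n} \<subseteq> carrier G" "\<And>x. x \<in> set w \<Longrightarrow> fst x < n"
  shows "word_eval G g (free_reduce w) = word_eval G g w"
  using assms(2)
proof (induction w)
  case (Cons a w)
  have "word_eval G g (free_reduce (a # w)) = word_eval G g (a # free_reduce w)"
    unfolding free_reduce_Cons using Cons.prems set_free_reduce[of w]
    by (intro word_eval_red_step[OF assms(1)]) auto
  then show ?case using Cons by (cases a) simp
qed simp

lemma word_eval_hom:
  assumes "g ` {..<n} \<subseteq> carrier G"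
  shows "group_hom (free_group n) G (word_eval G g)"
proof (intro group_hom.intro group_hom_axioms.intro group_free_group is_group homI)
  fix x assume "x \<in> carrier (free_group n)"
  then show "word_eval G g x \<in> carrier G"
    by (intro word_eval_closed[OF assms]) (auto simp: free_group_def)
next
  fix x y assume "x \<in> carrier (free_group n)" "y \<in> carrier (free_group n)"
  then have "\<And>z. z \<in> set x \<union> set y \<Longrightarrow> fst z < n" by (auto simp: free_group_def)
  then show "word_eval G g (x \<otimes>\<^bsub>free_group n\<^esub> y) = word_eval G g x \<otimes> word_eval G g y"
    using word_eval_free_reduce[OF assms, of "x @ y"] word_eval_append[OF assms, of x y]
    by (simp add: free_group_def)
qed

lemma generate_subset_word_eval_image:
  assumes "g ` {..<n} \<subseteq> carrier G"
  shows "generate G (g ` {..<n}) \<subseteq> word_eval G g ` carrier (free_group n)"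
proof (rule generate_subgroup_incl)
  interpret w: group_hom "free_group n" G "word_eval G g" by (rule word_eval_hom[OF assms])
  show "subgroup (word_eval G g ` carrier (free_group n)) G"
    by (rule w.img_is_subgroup)
  have "g i \<in> word_eval G g ` carrier (free_group n)" if "i < n" for i
  proof (rule image_eqI)
    show "g i = word_eval G g [(i, True)]" using that assms by auto
    show "[(i, True)] \<in> carrier (free_group n)" using that by (simp add: free_group_def red_step_def)
  qed
  then show "g ` {..<n} \<subseteq> word_eval G g ` carrier (free_group n)" by blast
qed

end

lemma (in group_hom) hom_word_eval:
  assumes "g ` {..<n} \<subseteq> carrier G" "w \<in> carrier (free_group n)"
  shows "h (word_eval G g w) = word_eval H (\<lambda>i. h (g i)) w"
proof -
  have "\<And>x. x \<in> set w \<Longrightarrow> fst x < n" using assms(2) by (auto simp: free_group_def)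
  then show ?thesis
  proof (induction w)
    case (Cons a w)
    have "g (fst a) \<in> carrier G" using Cons.prems[of a] assms(1) by (simp add: image_subset_iff)
    moreover have "word_eval G g w \<in> carrier G"
      using Cons.prems by (intro G.word_eval_closed[OF assms(1)]) auto
    ultimately show ?case using Cons by (cases a) auto
  qed simp
qed

section \<open>The covering group: quotient maps, Fitting subgroup and exponent\<close>

section \<open>The covering group\<close>

lemma cov_k_pos: "cov_k G > 0"
  by (auto simp: cov_k_def intro!: prod_pos prime_gt_0_nat)

text \<open>By Lagrange the F-rank is an exponent of the top factor;
  \<open>Fcs_admissible_pow\<close> lowers it to the product of its primes.\<close>

lemma (in bounded_Fitting) Fitting_pow_cov_k:
  assumes fin: "finite (carrier G)" and x: "x \<in> Fitting G"
  shows "x [^] cov_k G \<in> Fcs G 1"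
proof -
  let ?V = "Fcs G 0"
  let ?Q = "subgroup_generated G ?V Mod Fcs G 1"
  have V: "subgroup ?V G" "?V \<subseteq> Fitting G" by (rule Fcs_subgroup Fcs_subset_Fitting)+
  have adm: "Fcs_admissible G ?V (Fcs G 1)" using Fcs_Suc_admissible[of 0] by simp
  then have nV: "Fcs G 1 \<lhd> subgroup_generated G ?V" by (simp add: Fcs_admissible_def)
  interpret V: subgroup ?V G by fact
  interpret N: normal "Fcs G 1" "subgroup_generated G ?V" by fact
  interpret Q: group ?Q by (rule N.factorgroup_is_group)
  have car: "carrier ?Q = (\<lambda>x. Fcs G 1 #>\<^bsub>subgroup_generated G ?V\<^esub> x) ` ?V"
    by (simp add: carrier_FactGroup del: Fcs.simps)
  then have finQ: "finite (carrier ?Q)" using fin V.subset finite_subset by (metis finite_imageI)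
  have rank: "F_rank G = order ?Q" by (simp add: F_rank_def)
  have "y [^] F_rank G \<in> Fcs G 1" if y: "y \<in> ?V" for y
    using rcoset_pow_eq_one_iff[OF V(1) nV y, of "F_rank G"] Q.pow_order_eq_1 car y
    unfolding rank by blast
  moreover have "F_rank G \<noteq> 0" using finQ Q.order_gt_0_iff_finite rank by simp
  ultimately show ?thesis
    unfolding cov_k_def using x by (intro Fcs_admissible_pow[OF V adm]) auto
qed

locale cover = group +
  fixes g :: "nat \<Rightarrow> 'a" and n :: nat
  assumes g_closed: "g ` {..<n} \<subseteq> carrier G"
    and g_generates: "generate G (g ` {..<n}) = carrier G"
begin

abbreviation "F \<equiv> free_group n"
abbreviation "\<mu> \<equiv> word_eval G g"
abbreviation "R \<equiv> cov_R G g n"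
abbreviation "L \<equiv> cov_L G g n"
abbreviation "K \<equiv> cov_K G g n"
abbreviation "k \<equiv> cov_k G"
abbreviation "C \<equiv> covering_group G g n"
abbreviation "\<pi> \<equiv> \<lambda>x. K #>\<^bsub>F\<^esub> x"

sublocale \<mu>: group_hom F G \<mu> by (rule word_eval_hom[OF g_closed])

lemma \<mu>_surj: "\<mu> ` carrier F = carrier G"
  using generate_subset_word_eval_image[OF g_closed] g_generates by auto

lemma R_normal: "R \<lhd> F"
  using \<mu>.normal_kernel by (simp add: cov_R_def kernel_def)

lemma L_normal: "L \<lhd> F"
proof -
  interpret N: normal "Fitting G" G by (rule Fitting_normal)
  show ?thesis
    unfolding \<mu>.G.normal_inv_iff cov_L_def
    by (auto intro!: \<mu>.G.subgroupI N.inv_op_closed2)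
qed

lemma conj_closed: "N \<lhd> F \<Longrightarrow> a \<in> carrier F \<Longrightarrow> x \<in> N \<Longrightarrow> a \<otimes>\<^bsub>F\<^esub> x \<otimes>\<^bsub>F\<^esub> inv\<^bsub>F\<^esub> a \<in> N"
  by (rule normal.inv_op_closed2)

lemma comm_sub_eq: "comm_sub F R L = generate F {commutator F x y | x y. x \<in> R \<and> y \<in> L}"
  by (simp add: comm_sub_def commutator_def)

lemma R_carrier: "x \<in> R \<Longrightarrow> x \<in> carrier F" and L_carrier: "x \<in> L \<Longrightarrow> x \<in> carrier F"
  by (simp_all add: cov_R_def cov_L_def)

lemma comm_sub_normal: "comm_sub F R L \<lhd> F"
  unfolding comm_sub_eq
proof (rule \<mu>.G.normal_generateI)
  show "{commutator F x y | x y. x \<in> R \<and> y \<in> L} \<subseteq> carrier F"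
    using R_carrier L_carrier by auto
next
  fix z a assume "z \<in> {commutator F x y | x y. x \<in> R \<and> y \<in> L}" and a: "a \<in> carrier F"
  then obtain x y where xy: "z = commutator F x y" "x \<in> R" "y \<in> L" by blast
  have "a \<otimes>\<^bsub>F\<^esub> z \<otimes>\<^bsub>F\<^esub> inv\<^bsub>F\<^esub> a
      = commutator F (a \<otimes>\<^bsub>F\<^esub> x \<otimes>\<^bsub>F\<^esub> inv\<^bsub>F\<^esub> a) (a \<otimes>\<^bsub>F\<^esub> y \<otimes>\<^bsub>F\<^esub> inv\<^bsub>F\<^esub> a)"
    unfolding xy(1) using a R_carrier[OF xy(2)] L_carrier[OF xy(3)] by (rule \<mu>.G.conj_commutator)
  then show "a \<otimes>\<^bsub>F\<^esub> z \<otimes>\<^bsub>F\<^esub> inv\<^bsub>F\<^esub> a \<in> {commutator F x y | x y. x \<in> R \<and> y \<in> L}"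
    using conj_closed[OF R_normal a xy(2)] conj_closed[OF L_normal a xy(3)] by blast
qed

lemma pow_sub_normal: "pow_sub F R k \<lhd> F"
  unfolding pow_sub_def
proof (rule \<mu>.G.normal_generateI)
  show "{x [^]\<^bsub>F\<^esub> k | x. x \<in> R} \<subseteq> carrier F" using R_carrier by auto
next
  fix z a assume "z \<in> {x [^]\<^bsub>F\<^esub> k | x. x \<in> R}" and a: "a \<in> carrier F"
  then obtain x where x: "z = x [^]\<^bsub>F\<^esub> k" "x \<in> R" by blast
  have "a \<otimes>\<^bsub>F\<^esub> z \<otimes>\<^bsub>F\<^esub> inv\<^bsub>F\<^esub> a = (a \<otimes>\<^bsub>F\<^esub> x \<otimes>\<^bsub>F\<^esub> inv\<^bsub>F\<^esub> a) [^]\<^bsub>F\<^esub> k"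
    unfolding x(1) using a R_carrier[OF x(2)] by (rule \<mu>.G.conj_nat_pow)
  then show "a \<otimes>\<^bsub>F\<^esub> z \<otimes>\<^bsub>F\<^esub> inv\<^bsub>F\<^esub> a \<in> {x [^]\<^bsub>F\<^esub> k | x. x \<in> R}"
    using conj_closed[OF R_normal a x(2)] by blast
qed

lemma K_normal: "K \<lhd> F"
  unfolding cov_K_def
  by (rule \<mu>.G.normal_subgroup_set_mult_closed[OF comm_sub_normal pow_sub_normal])

sublocale K: normal K F by (rule K_normal)

lemma commutator_in_K:
  assumes "x \<in> R" "y \<in> L"
  shows "commutator F x y \<in> K"
proof -
  have "commutator F x y \<in> comm_sub F R L"
    unfolding comm_sub_eq using assms by (intro generate.incl) blast
  moreover have "\<one>\<^bsub>F\<^esub> \<in> pow_sub F R k" unfolding pow_sub_def by (rule generate.one)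
  ultimately have "commutator F x y \<otimes>\<^bsub>F\<^esub> \<one>\<^bsub>F\<^esub> \<in> K"
    unfolding cov_K_def set_mult_def by blast
  then show ?thesis using R_carrier[OF assms(1)] L_carrier[OF assms(2)] by simp
qed

lemma pow_in_K:
  assumes "x \<in> R"
  shows "x [^]\<^bsub>F\<^esub> k \<in> K"
proof -
  have "x [^]\<^bsub>F\<^esub> k \<in> pow_sub F R k"
    unfolding pow_sub_def using assms by (intro generate.incl) blast
  moreover have "\<one>\<^bsub>F\<^esub> \<in> comm_sub F R L" unfolding comm_sub_def by (rule generate.one)
  ultimately have "\<one>\<^bsub>F\<^esub> \<otimes>\<^bsub>F\<^esub> (x [^]\<^bsub>F\<^esub> k) \<in> K"
    unfolding cov_K_def set_mult_def by blast
  then show ?thesis using R_carrier[OF assms] by simp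
qed

lemma K_subset:
  assumes S: "subgroup S F" and "\<And>x y. x \<in> R \<Longrightarrow> y \<in> L \<Longrightarrow> commutator F x y \<in> S"
    and "\<And>x. x \<in> R \<Longrightarrow> x [^]\<^bsub>F\<^esub> k \<in> S"
  shows "K \<subseteq> S"
proof -
  have "comm_sub F R L \<subseteq> S" unfolding comm_sub_eq
    using assms(2) by (intro \<mu>.G.generate_subgroup_incl[OF _ S]) blast
  moreover have "pow_sub F R k \<subseteq> S" unfolding pow_sub_def
    using assms(3) by (intro \<mu>.G.generate_subgroup_incl[OF _ S]) blast
  ultimately show ?thesis
    unfolding cov_K_def set_mult_def using subgroup.m_closed[OF S] by blast
qed

lemma C_group: "group C"
  unfolding covering_group_def by (rule K.factorgroup_is_group)

sublocale \<pi>: group_hom F C \<pi>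
  by (intro group_hom.intro group_hom_axioms.intro \<mu>.G.is_group C_group)
    (simp add: covering_group_def K.r_coset_hom_Mod)

lemma C_carrier: "carrier C = \<pi> ` carrier F"
  by (simp add: covering_group_def carrier_FactGroup)

lemma \<pi>_eq_one: "x \<in> K \<Longrightarrow> \<pi> x = \<one>\<^bsub>C\<^esub>"
  using \<mu>.G.coset_join2[OF K.mem_carrier K.subgroup_axioms] by (simp add: covering_group_def)

lemma C_countable: "countable_group C"
proof -
  interpret C: group C by (rule C_group)
  show ?thesis by unfold_locales (simp add: C_carrier)
qed

lemma K_subset_kernel: "K \<subseteq> kernel F G \<mu>"
proof (rule K_subset[OF \<mu>.subgroup_kernel])
  fix x y assume "x \<in> R" "y \<in> L"
  then show "commutator F x y \<in> kernel F G \<mu>"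
    by (simp add: kernel_def cov_R_def cov_L_def \<mu>.hom_commutator)
qed (simp add: kernel_def cov_R_def \<mu>.hom_nat_pow)

text \<open>Applied twice: to \<open>\<mu>\<close>, giving the projection of the covering group onto
  \<open>G\<close>, and to the evaluation at lifted generators in a descendant.\<close>

lemma induced_hom:
  assumes "group_hom F H \<psi>" "K \<subseteq> kernel F H \<psi>"
  obtains \<phi> where "group_hom C H \<phi>" "\<And>x. x \<in> carrier F \<Longrightarrow> \<phi> (\<pi> x) = \<psi> x"
proof -
  interpret \<psi>: group_hom F H \<psi> by fact
  obtain \<phi> where \<phi>: "\<phi> \<in> hom (F Mod K) H" "\<And>x. x \<in> carrier F \<Longrightarrow> \<phi> (\<pi> x) = \<psi> x"
    using \<psi>.FactGroup_universal_kernel[OF K_normal assms(2)] by blast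
  have "group_hom C H \<phi>"
    by (intro group_hom.intro group_hom_axioms.intro C_group \<psi>.H.is_group)
      (use \<phi>(1) in \<open>simp add: covering_group_def\<close>)
  then show thesis using that \<phi>(2) by blast
qed

text \<open>The kernel of the projection to \<open>G\<close> is the image of \<open>R\<close>. Since
  \<open>[R, L]\<close> is factored out, the image of \<open>L\<close> centralises it, so one upper
  central step absorbs the kernel.\<close>

lemma C_Fitting:
  assumes nilp: "Fitting G \<subseteq> upper_central G (Fitting G) m"
  shows "Fitting C = \<pi> ` L"
proof -
  obtain \<nu> where hom: "group_hom C G \<nu>" and \<nu>: "\<And>x. x \<in> carrier F \<Longrightarrow> \<nu> (\<pi> x) = \<mu> x"
    using induced_hom[OF \<mu>.group_hom_axioms K_subset_kernel] by blast
  interpret \<nu>: group_hom C G \<nu> by fact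
  let ?A = "{x \<in> carrier C. \<nu> x \<in> Fitting G}"
  have AL: "?A = \<pi> ` L" by (auto simp: C_carrier \<nu> cov_L_def)
  have ker: "kernel C G \<nu> = \<pi> ` R" by (auto simp: kernel_def C_carrier \<nu> cov_R_def)
  have RL: "R \<subseteq> L"
    using subgroup.one_closed[OF Fitting_subgroup] by (auto simp: cov_R_def cov_L_def)
  have "\<nu> ` carrier C = carrier G"
    unfolding C_carrier image_image using \<mu>_surj by (simp add: \<nu> cong: image_cong)
  moreover have "kernel C G \<nu> \<subseteq> upper_central C ?A 1"
  proof -
    have "commutator C (\<pi> x) (\<pi> y) = \<one>\<^bsub>C\<^esub>" if "x \<in> R" "y \<in> L" for x y
      using \<pi>_eq_one[OF commutator_in_K[OF that]] R_carrier[OF that(1)] L_carrier[OF that(2)]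
      by (simp add: \<pi>.hom_commutator)
    then show ?thesis unfolding ker AL using RL by auto
  qed
  ultimately show ?thesis using \<nu>.Fitting_eq_vimage[OF _ nilp] AL by blast
qed

text \<open>The power with exponent \<open>order G\<close> sends \<open>L\<close> into
  \<open>R\<close>, and \<open>k\<close>-th powers of \<open>R\<close> lie in
  \<open>K\<close>.\<close>

lemma C_bounded_Fitting:
  assumes nilp: "Fitting G \<subseteq> upper_central G (Fitting G) m" and fin: "finite (carrier G)"
  shows "bounded_Fitting C (order G * k)"
proof (intro bounded_Fitting.intro C_countable bounded_Fitting_axioms.intro)
  show "order G * k \<noteq> 0" using fin cov_k_pos[of G] order_gt_0_iff_finite by simp
next
  fix x assume "x \<in> Fitting C"
  then obtain y where y: "y \<in> L" "x = \<pi> y" using C_Fitting[OF nilp] by blast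
  have yF: "y \<in> carrier F" using y L_carrier by blast
  have "y [^]\<^bsub>F\<^esub> order G \<in> R"
    using yF pow_order_eq_1 by (simp add: cov_R_def \<mu>.hom_nat_pow)
  then have "(y [^]\<^bsub>F\<^esub> order G) [^]\<^bsub>F\<^esub> k \<in> K" by (rule pow_in_K)
  then have "y [^]\<^bsub>F\<^esub> (order G * k) \<in> K" using yF by (simp add: \<mu>.G.nat_pow_pow)
  then have "\<pi> (y [^]\<^bsub>F\<^esub> (order G * k)) = \<one>\<^bsub>C\<^esub>" by (rule \<pi>_eq_one)
  then show "x [^]\<^bsub>C\<^esub> (order G * k) = \<one>\<^bsub>C\<^esub>" using y(2) yF by (simp add: \<pi>.hom_nat_pow)
qed

end

section \<open>Descendants as quotients of the covering group\<close>

lemma has_F_class_unique: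
  assumes "has_F_class G c" "has_F_class G d"
  shows "c = d"
proof -
  have "\<not> c < d" "\<not> d < c" using assms unfolding has_F_class_def by blast+
  then show ?thesis by simp
qed

lemma (in group) bounded_Fitting_order:
  assumes "finite (carrier G)"
  shows "bounded_Fitting G (order G)"
proof
  show "countable (carrier G)" using assms by (rule countable_finite)
  show "order G \<noteq> 0" using assms order_gt_0_iff_finite by simp
  show "x [^] order G = \<one>" if "x \<in> Fitting G" for x
    using that subgroup.mem_carrier[OF Fitting_subgroup] pow_order_eq_1 by blast
qed

lemma descendant_hom:
  assumes G: "group G" and H: "bounded_Fitting H e" and desc: "descendant H G" and c: "has_F_class G c"
  obtains \<theta> where "group_hom H G \<theta>" "\<theta> ` carrier H = carrier G"
    "kernel H G \<theta> = Fcs H c" "has_F_class H (Suc c)"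
proof -
  interpret H: bounded_Fitting H e by fact
  let ?Z = "Fcs H c"
  interpret Z: normal ?Z H by (rule H.Fcs_normal)
  \<comment> \<open>\<open>descendant\<close> quantifies over its own class, which uniqueness
    identifies with \<open>c\<close>.\<close>
  have cls: "has_F_class H (Suc c)" and "H Mod ?Z \<cong> G"
    using desc c has_F_class_unique unfolding descendant_def by blast+
  then obtain f where f: "f \<in> iso (H Mod ?Z) G" by (auto simp: is_iso_def)
  interpret f: group_hom "H Mod ?Z" G f
    using f by (intro group_hom.intro group_hom_axioms.intro Z.factorgroup_is_group G) (simp add: iso_def)
  have fbij: "f ` carrier (H Mod ?Z) = carrier G" "inj_on f (carrier (H Mod ?Z))"
    using f by (auto simp: iso_def bij_betw_def)
  let ?\<theta> = "\<lambda>x. f (?Z #>\<^bsub>H\<^esub> x)"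
  have "(f \<circ> (\<lambda>x. ?Z #>\<^bsub>H\<^esub> x)) \<in> hom H G"
    using Z.r_coset_hom_Mod f.homh by (rule hom_compose)
  then have "group_hom H G ?\<theta>"
    by (intro group_hom.intro group_hom_axioms.intro H.is_group G) (simp add: o_def)
  moreover have "?\<theta> ` carrier H = carrier G"
    using fbij(1) unfolding carrier_FactGroup image_image .
  moreover have "kernel H G ?\<theta> = ?Z"
  proof -
    have "?\<theta> x = \<one>\<^bsub>G\<^esub> \<longleftrightarrow> x \<in> ?Z" if x: "x \<in> carrier H" for x
    proof -
      have "?Z #>\<^bsub>H\<^esub> x \<in> carrier (H Mod ?Z)" using x by (simp add: carrier_FactGroup)
      then have "?\<theta> x = \<one>\<^bsub>G\<^esub> \<longleftrightarrow> ?Z #>\<^bsub>H\<^esub> x = ?Z"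
        using inj_on_eq_iff[OF fbij(2), of "?Z #>\<^bsub>H\<^esub> x" "\<one>\<^bsub>H Mod ?Z\<^esub>"] f.hom_one f.G.one_closed by simp
      also have "\<dots> \<longleftrightarrow> x \<in> ?Z"
        using x H.coset_join1[OF _ x Z.subgroup_axioms] H.coset_join2[OF x Z.subgroup_axioms] by blast
      finally show ?thesis .
    qed
    then show ?thesis unfolding kernel_def using Z.subset by blast
  qed
  ultimately show thesis using that cls by blast
qed

theorem theorem4p6:
  fixes G :: "('a, 'b) monoid_scheme" and H :: "('c, 'd) monoid_scheme"
    and g :: "nat \<Rightarrow> 'a" and n c :: nat
  assumes "group G" and "finite (carrier G)"
    and "g ` {..<n} \<subseteq> carrier G" and "generate G (g ` {..<n}) = carrier G"
    and "has_F_class G c" and "c \<ge> 1"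
    and "group H" and "finite (carrier H)" and "descendant H G"
  shows "\<exists>U. allowable G g n c U \<and> H \<cong> (covering_group G g n Mod U)"
proof -
  interpret G: bounded_Fitting G "order G"
    using assms(1,2) by (rule group.bounded_Fitting_order)
  interpret H: bounded_Fitting H "order H"
    using assms(7,8) by (rule group.bounded_Fitting_order)
  interpret G: cover G g n by unfold_locales fact+
  obtain \<theta> where hom: "group_hom H G \<theta>" and surj: "\<theta> ` carrier H = carrier G"
    and ker: "kernel H G \<theta> = Fcs H c" and cls: "has_F_class H (Suc c)"
    using descendant_hom[OF assms(1) H.bounded_Fitting_axioms assms(9,5)] .
  interpret \<theta>: group_hom H G \<theta> by fact
  obtain b where c: "c = Suc b" using assms(6) by (metis Suc_le_D One_nat_def)
  have nilp: "Fitting G \<subseteq> upper_central G (Fitting G) c"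
    using assms(5) by (rule G.F_class_imp_nilpotent)
  have E: "F_extension H G \<theta> (order H) b c"
  proof (intro F_extension.intro F_extension_axioms.intro hom H.bounded_Fitting_axioms
        G.countable_group_axioms surj nilp)
    show "kernel H G \<theta> = Fcs H (Suc b)" using ker unfolding c .
    show "Fcs H (Suc (Suc b)) = {\<one>\<^bsub>H\<^esub>}" using cls unfolding c has_F_class_def by blast
  qed

  have "\<forall>i\<in>{..<n}. \<exists>y. y \<in> carrier H \<and> \<theta> y = g i"
  proof
    fix i assume "i \<in> {..<n}"
    then have "g i \<in> \<theta> ` carrier H" unfolding surj using assms(3) by blast
    then show "\<exists>y. y \<in> carrier H \<and> \<theta> y = g i" by (metis imageE)
  qed
  then obtain y where y: "\<And>i. i < n \<Longrightarrow> y i \<in> carrier H \<and> \<theta> (y i) = g i"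
    using bchoice[of "{..<n}" "\<lambda>i y. y \<in> carrier H \<and> \<theta> y = g i"] by blast
  have yc: "y ` {..<n} \<subseteq> carrier H" using y by blast
  define \<psi> where "\<psi> = word_eval H y"
  interpret \<psi>: group_hom G.F H \<psi> unfolding \<psi>_def by (rule H.word_eval_hom[OF yc])
  have \<theta>\<psi>: "\<theta> (\<psi> w) = G.\<mu> w" if w: "w \<in> carrier G.F" for w
  proof -
    have "word_eval G (\<lambda>i. \<theta> (y i)) w = word_eval G g w"
      using w y by (intro G.word_eval_cong[of n]) (auto simp: free_group_def)
    then show ?thesis unfolding \<psi>_def using \<theta>.hom_word_eval[OF yc w] by simp
  qed
  \<comment> \<open>The lifts were chosen arbitrarily; they generate \<open>H\<close> because a
    subgroup of \<open>H\<close> that covers \<open>G\<close> is all of \<open>H\<close>.\<close>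
  have "generate H (y ` {..<n}) = carrier H"
  proof (rule F_extension.subgroup_eq_carrier[OF E])
    show "subgroup (generate H (y ` {..<n})) H" using yc by (rule H.generate_is_subgroup)
    have "\<theta> ` y ` {..<n} = g ` {..<n}" unfolding image_image using y by (intro image_cong) auto
    then show "carrier G \<subseteq> \<theta> ` generate H (y ` {..<n})"
      using \<theta>.generate_img[OF yc] assms(4) by simp
  qed
  then have \<psi>_surj: "\<psi> ` carrier G.F = carrier H"
    unfolding \<psi>_def using H.generate_subset_word_eval_image[OF yc] \<psi>.hom_closed \<psi>_def by blast
  have \<psi>R: "\<psi> x \<in> kernel H G \<theta>" if "x \<in> G.R" for x
    using that \<theta>\<psi> by (auto simp: kernel_def cov_R_def)
  have \<psi>L: "\<psi> x \<in> Fitting H" if "x \<in> G.L" for x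
    using that \<theta>\<psi> unfolding F_extension.Fitting_vimage[OF E] by (auto simp: cov_L_def)

  \<comment> \<open>\<open>\<psi>\<close> sends \<open>R\<close> into \<open>Z\<close> and
    \<open>L\<close> into the Fitting subgroup, which centralises \<open>Z\<close>; also
    \<open>Z\<close> has exponent dividing \<open>k\<close>. So both kinds of generators of
    \<open>K\<close> vanish.\<close>
  have "G.K \<subseteq> kernel G.F H \<psi>"
  proof (rule G.K_subset[OF \<psi>.subgroup_kernel])
    fix x z assume xz: "x \<in> G.R" "z \<in> G.L"
    have xzF: "x \<in> carrier G.F" "z \<in> carrier G.F" using xz G.R_carrier G.L_carrier by blast+
    have "\<psi> z \<otimes>\<^bsub>H\<^esub> \<psi> x = \<psi> x \<otimes>\<^bsub>H\<^esub> \<psi> z"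
      using F_extension.Z_central[OF E \<psi>L[OF xz(2)]] \<psi>R[OF xz(1)] ker c by simp
    then have "commutator H (\<psi> x) (\<psi> z) = \<one>\<^bsub>H\<^esub>"
      using xzF by (simp add: H.commutator_eq_one_iff)
    then show "commutator G.F x z \<in> kernel G.F H \<psi>"
      using xzF by (simp add: kernel_def \<psi>.hom_commutator)
  next
    fix x assume x: "x \<in> G.R"
    have "\<psi> x [^]\<^bsub>H\<^esub> G.k = \<one>\<^bsub>H\<^esub>"
      using G.Fitting_pow_cov_k[OF assms(2)] \<psi>R[OF x] by (rule F_extension.kernel_pow[OF E])
    then show "x [^]\<^bsub>G.F\<^esub> G.k \<in> kernel G.F H \<psi>"
      using G.R_carrier[OF x] by (simp add: kernel_def \<psi>.hom_nat_pow)
  qed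
  then obtain \<phi> where \<phi>hom: "group_hom G.C H \<phi>"
    and \<phi>: "\<And>x. x \<in> carrier G.F \<Longrightarrow> \<phi> (G.\<pi> x) = \<psi> x"
    using G.induced_hom[OF \<psi>.group_hom_axioms] by blast
  interpret \<phi>: group_hom G.C H \<phi> by fact
  have \<phi>_surj: "\<phi> ` carrier G.C = carrier H"
    unfolding G.C_carrier image_image using \<psi>_surj by (simp add: \<phi> cong: image_cong)
  \<comment> \<open>Because \<open>\<theta> (\<psi> w) = \<mu> w\<close>, the full preimage of
    \<open>Z\<close> under \<open>\<phi>\<close> is \<open>M\<close>.\<close>
  have \<theta>\<phi>_ker: "x \<in> cov_M G g n \<longleftrightarrow> \<phi> x \<in> kernel H G \<theta>" if "x \<in> carrier G.C" for x
  proof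
    assume "x \<in> cov_M G g n"
    then show "\<phi> x \<in> kernel H G \<theta>"
      unfolding cov_M_def using \<psi>R G.R_carrier by (auto simp: \<phi>)
  next
    assume *: "\<phi> x \<in> kernel H G \<theta>"
    obtain w where w: "w \<in> carrier G.F" "x = G.\<pi> w" using \<open>x \<in> carrier G.C\<close> G.C_carrier by blast
    then have "w \<in> G.R" using * \<theta>\<psi>[OF w(1)] by (simp add: \<phi> kernel_def cov_R_def)
    then show "x \<in> cov_M G g n" using w by (simp add: cov_M_def)
  qed
  have M_carrier: "cov_M G g n \<subseteq> carrier G.C"
    unfolding cov_M_def G.C_carrier using G.R_carrier by blast

  \<comment> \<open>For surjectivity, a word evaluating into \<open>Fitting H\<close> lies in
    \<open>L\<close>, because \<open>Fitting_vimage\<close> decides membership after projection to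
    \<open>G\<close>.\<close>
  have "\<phi> ` Fitting G.C = Fitting H"
  proof -
    have "\<phi> ` Fitting G.C = \<psi> ` G.L"
      unfolding G.C_Fitting[OF nilp] image_image using G.L_carrier by (intro image_cong) (auto simp: \<phi>)
    also have "\<dots> = Fitting H"
    proof (intro equalityI subsetI)
      fix x assume x: "x \<in> Fitting H"
      then have xc: "x \<in> carrier H" "\<theta> x \<in> Fitting G" using F_extension.Fitting_vimage[OF E] by auto
      then obtain w where w: "w \<in> carrier G.F" "x = \<psi> w" using \<psi>_surj by blast
      then have "w \<in> G.L" using xc \<theta>\<psi>[OF w(1)] by (simp add: cov_L_def)
      then show "x \<in> \<psi> ` G.L" using w by blast
    qed (use \<psi>L in blast)
    finally show ?thesis .
  qed
  \<comment> \<open>The two F-central series correspond under \<open>\<phi>\<close>; at index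
    \<open>c\<close> the nucleus meets \<open>Z\<close>.\<close>
  then have nuc: "\<phi> ` nucleus G g n c = kernel H G \<theta>"
    unfolding nucleus_def ker
    by (rule \<phi>.image_Fcs[OF G.C_bounded_Fitting[OF nilp assms(2)] H.countable_group_axioms])
  interpret C: countable_group G.C by (rule G.C_countable)
  have nuc_carrier: "nucleus G g n c \<subseteq> carrier G.C"
    unfolding nucleus_def by (rule subgroup.subset[OF C.Fcs_subgroup])

  let ?U = "kernel G.C H \<phi>"
  have "cov_M G g n = nucleus G g n c <#>\<^bsub>G.C\<^esub> ?U"
  proof (intro equalityI subsetI)
    fix x assume x: "x \<in> cov_M G g n"
    then have xc: "x \<in> carrier G.C" using M_carrier by blast
    \<comment> \<open>Dividing \<open>x\<close> by a nucleus element with the same image leaves a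
      factor in the kernel.\<close>
    have "\<phi> x \<in> \<phi> ` nucleus G g n c" unfolding nuc using \<theta>\<phi>_ker[OF xc] x by blast
    then obtain v where v: "v \<in> nucleus G g n c" "\<phi> x = \<phi> v" by blast
    have vc: "v \<in> carrier G.C" using v nuc_carrier by blast
    have "inv\<^bsub>G.C\<^esub> v \<otimes>\<^bsub>G.C\<^esub> x \<in> ?U" using v vc xc by (simp add: kernel_def)
    moreover have "x = v \<otimes>\<^bsub>G.C\<^esub> (inv\<^bsub>G.C\<^esub> v \<otimes>\<^bsub>G.C\<^esub> x)" using vc xc by (simp add: group.inv_mult_cancel[OF G.C_group])
    ultimately show "x \<in> nucleus G g n c <#>\<^bsub>G.C\<^esub> ?U" unfolding set_mult_def using v(1) by blast
  next
    fix x assume "x \<in> nucleus G g n c <#>\<^bsub>G.C\<^esub> ?U"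
    then obtain v u where vu: "v \<in> nucleus G g n c" "u \<in> ?U" "x = v \<otimes>\<^bsub>G.C\<^esub> u"
      unfolding set_mult_def by blast
    then have vuc: "v \<in> carrier G.C" "u \<in> carrier G.C" "\<phi> u = \<one>\<^bsub>H\<^esub>"
      using nuc_carrier by (auto simp: kernel_def)
    then have "\<phi> x = \<phi> v" using vu by simp
    then have "\<phi> x \<in> kernel H G \<theta>" using nuc vu(1) by blast
    then show "x \<in> cov_M G g n" using \<theta>\<phi>_ker[of x] vu vuc by simp
  qed
  moreover have "?U \<subseteq> cov_M G g n"
    using \<theta>\<phi>_ker by (auto simp: kernel_def)
  moreover have "?U \<noteq> cov_M G g n"
  proof
    assume eq: "?U = cov_M G g n"
    \<comment> \<open>The image of \<open>M\<close> is \<open>Z\<close>, so a kernel equal to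
      \<open>M\<close> would make \<open>Z\<close> trivial, against the class \<open>Suc c\<close>
      of \<open>H\<close>.\<close>
    have "Fcs H c \<subseteq> {\<one>\<^bsub>H\<^esub>}"
    proof
      fix z assume z: "z \<in> Fcs H c"
      then have "z \<in> carrier H" using ker by (auto simp: kernel_def)
      then obtain x where x: "x \<in> carrier G.C" "z = \<phi> x" using \<phi>_surj by blast
      then have "x \<in> ?U" using \<theta>\<phi>_ker z ker eq by blast
      then show "z \<in> {\<one>\<^bsub>H\<^esub>}" using x by (simp add: kernel_def)
    qed
    then have "Fcs H c = {\<one>\<^bsub>H\<^esub>}" using subgroup.one_closed[OF H.Fcs_subgroup] by blast
    then show False using cls by (simp add: has_F_class_def)
  qed
  ultimately have "allowable G g n c ?U"
    unfolding allowable_def using \<phi>.subgroup_kernel \<phi>.normal_kernel by blast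
  moreover have "H \<cong> G.C Mod ?U"
    using normal.factorgroup_is_group[OF \<phi>.normal_kernel] \<phi>.FactGroup_iso[OF \<phi>_surj]
    by (rule group.iso_sym)
  ultimately show ?thesis by blast
qed

end
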